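(* Let $X$ be an infinite-dimensional real Banach space, $\mathcal D$ a fundamental sub-semigroup of $\mathcal C(X)$, $\mu$ a convex measure of non-property $\mathfrak D$ (with respect to $\mathcal D$) on $X$, $I=[0,a]$ with $a>0$, $G\subseteq L_1(I,X)$ a nonempty bounded subset, and $\psi\in L_1(I,\mathbb R^+)$ such that $\sup_{g\in G}\|g(t)\|\le\psi(t)$ for a.e. $t\in I$. Assume that $\mathbb J_G:I\to C_b(\Omega)$ is strongly measurable. Then, for $0<t\le a$, the inequality $$\mu\Big(\int_0^tG(s)\,ds\Big)\le\int_0^t\mu\big(G(s)\big)\,ds$$ holds if one of the following conditions is satisfied: (i) $0<t\le\min\{1,a\}$; (ii) $\mu$ is a sublinear measure of non-property $\mathfrak D$.
   Context: $\mathcal B(X)$ is the set of nonempty bounded subsets of $X$; $\mathcal C(X)$ is the set of nonempty closed bounded convex subsets of $X$ with addition $A\oplus B=\overline{A+B}$, scalar multiplication of sets, and the Hausdorff metric. A fundamental sub-semigroup of $\mathcal C(X)$ is a subset $\mathcal D\subset\mathcal C(X)$, closed in the Hausdorff metric and closed under $\oplus$ and scalar multiplication, such that: $\bigcup\{D\in\mathcal D\}=X$; $A,B\in\mathcal D$ entails $\overline{\rm co}(\pm A\cup\pm B)\in\mathcal D$, where $\pm A\cup\pm B=A\cup(-A)\cup B\cup(-B)$; and $\emptyset\ne B\subset D\in\mathcal D$ implies $\overline{\rm co}(B)\in\mathcal D$. A convex measure of non-property $\mathfrak D$ (with respect to $\mathcal D$) on $X$ is a function $\mu:\mathcal B(X)\to[0,\infty)$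 such that for all $A,B\in\mathcal B(X)$: (1) $\mu(B)=0$ iff $\overline{\rm co}(B)\in\mathcal D$; (2) $A\supset B$ implies $\mu(A)\ge\mu(B)$; (3) $\mu({\rm co}(B))=\mu(B)$; (4) $\mu(\lambda A+(1-\lambda)B)\le\lambda\mu(A)+(1-\lambda)\mu(B)$ for $0\le\lambda\le1$. A sublinear measure of non-property $\mathfrak D$ is a function satisfying (1), (2), (3) together with $\mu(A+B)\le\mu(A)+\mu(B)$ and $\mu(kB)=k\mu(B)$ for all $k\ge0$. $L_1(I,X)$ is the space of Lebesgue–Bochner integrable $X$-valued functions on $I$; $G(t)=\{g(t):g\in G\}$ and $\int_0^tG(s)ds=\{\int_0^tg(s)ds:g\in G\}$. The integral on the right may be $+\infty$. $\Omega=B_{X^*}$ with the norm topology, $C_b(\Omega)$ is the Banach space of bounded continuous real functions on $\Omega$ with the sup-norm, and $\mathbb J_G$ is defined (for a.e. $t$) by $\mathbb J_G(t)(x^* )=\sup_{g\in G}\langle x^*,g(t)\rangle$, $x^*\in\Omega$. Strongly measurable means being the a.e. norm-limit of a sequence of simple functions. *)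

theory Defs
  imports "HOL-Analysis.Analysis"
begin

section \<open>Hyperspaces of bounded sets\<close>

definition bounded_sets :: "'a::real_normed_vector set set" where
  "bounded_sets = {B. B \<noteq> {} \<and> bounded B}"

definition closed_bounded_convex_sets :: "'a::real_normed_vector set set" where
  "closed_bounded_convex_sets = {C. C \<noteq> {} \<and> closed C \<and> bounded C \<and> convex C}"

definition hausdorff_dist :: "'a::metric_space set \<Rightarrow> 'a set \<Rightarrow> real" where
  "hausdorff_dist A B = max (SUP a\<in>A. infdist a B) (SUP b\<in>B. infdist b A)"

definition closed_convex_hull :: "'a::real_normed_vector set \<Rightarrow> 'a set" where
  "closed_convex_hull B = closure (convex hull B)"

definition fundamental_subsemigroup :: "'a::real_normed_vector set set \<Rightarrow> bool" where
  "fundamental_subsemigroup \<D> \<longleftrightarrow>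
     \<D> \<subseteq> closed_bounded_convex_sets \<and>
     (\<forall>S C. (\<forall>n::nat. S n \<in> \<D>) \<and> C \<in> closed_bounded_convex_sets \<and>
        (\<lambda>n. hausdorff_dist (S n) C) \<longlonglongrightarrow> 0 \<longrightarrow> C \<in> \<D>) \<and>
     (\<forall>A\<in>\<D>. \<forall>B\<in>\<D>. closure (A + B) \<in> \<D>) \<and>
     (\<forall>A\<in>\<D>. \<forall>r. (*\<^sub>R) r ` A \<in> \<D>) \<and>
     \<Union>\<D> = UNIV \<and>
     (\<forall>A\<in>\<D>. \<forall>B\<in>\<D>. closed_convex_hull (A \<union> uminus ` A \<union> B \<union> uminus ` B) \<in> \<D>) \<and>
     (\<forall>D\<in>\<D>. \<forall>B. B \<noteq> {} \<and> B \<subseteq> D \<longrightarrow> closed_convex_hull B \<in> \<D>)"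

section \<open>Measures of non-property\<close>

text \<open>The set functions are total; only their values on \<^const>\<open>bounded_sets\<close> matter.\<close>

definition nonproperty_measure :: "'a::real_normed_vector set set \<Rightarrow> ('a set \<Rightarrow> real) \<Rightarrow> bool" where
  "nonproperty_measure \<D> \<mu> \<longleftrightarrow>
     (\<forall>B\<in>bounded_sets. 0 \<le> \<mu> B) \<and>
     (\<forall>B\<in>bounded_sets. \<mu> B = 0 \<longleftrightarrow> closed_convex_hull B \<in> \<D>) \<and>
     (\<forall>A\<in>bounded_sets. \<forall>B\<in>bounded_sets. B \<subseteq> A \<longrightarrow> \<mu> B \<le> \<mu> A) \<and>
     (\<forall>B\<in>bounded_sets. \<mu> (convex hull B) = \<mu> B)"

definition convex_nonproperty_measure ::
    "'a::real_normed_vector set set \<Rightarrow> ('a set \<Rightarrow> real) \<Rightarrow> bool" where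
  "convex_nonproperty_measure \<D> \<mu> \<longleftrightarrow>
     nonproperty_measure \<D> \<mu> \<and>
     (\<forall>A\<in>bounded_sets. \<forall>B\<in>bounded_sets. \<forall>r. 0 \<le> r \<and> r \<le> 1 \<longrightarrow>
        \<mu> ((*\<^sub>R) r ` A + (*\<^sub>R) (1 - r) ` B) \<le> r * \<mu> A + (1 - r) * \<mu> B)"

definition sublinear_nonproperty_measure ::
    "'a::real_normed_vector set set \<Rightarrow> ('a set \<Rightarrow> real) \<Rightarrow> bool" where
  "sublinear_nonproperty_measure \<D> \<mu> \<longleftrightarrow>
     nonproperty_measure \<D> \<mu> \<and>
     (\<forall>A\<in>bounded_sets. \<forall>B\<in>bounded_sets. \<mu> (A + B) \<le> \<mu> A + \<mu> B) \<and>
     (\<forall>B\<in>bounded_sets. \<forall>k\<ge>0. \<mu> ((*\<^sub>R) k ` B) = k * \<mu> B)"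

section \<open>Bochner integration without separability\<close>

text \<open>
  The Bochner integral of HOL-Analysis requires a second countable codomain. Here the codomain is
  arbitrary, so Borel measurability of the integrand is replaced by strong measurability; otherwise
  the definition is that of \<^const>\<open>Bochner_Integration.has_bochner_integral\<close>.
\<close>

definition strongly_measurable :: "'b measure \<Rightarrow> ('b \<Rightarrow> 'a::real_normed_vector) \<Rightarrow> bool" where
  "strongly_measurable M f \<longleftrightarrow>
     (\<exists>s. (\<forall>i::nat. simple_function M (s i)) \<and> (AE x in M. (\<lambda>i. s i x) \<longlonglongrightarrow> f x))"

definition has_strong_bochner_integral ::
    "'b measure \<Rightarrow> ('b \<Rightarrow> 'a::real_normed_vector) \<Rightarrow> 'a \<Rightarrow> bool" where
  "has_strong_bochner_integral M f x \<longleftrightarrow>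
     strongly_measurable M f \<and>
     (\<exists>s. (\<forall>i::nat. Bochner_Integration.simple_bochner_integrable M (s i)) \<and>
        (\<lambda>i. \<integral>\<^sup>+y. ennreal (norm (f y - s i y)) \<partial>M) \<longlonglongrightarrow> 0 \<and>
        (\<lambda>i. Bochner_Integration.simple_bochner_integral M (s i)) \<longlonglongrightarrow> x)"

definition strong_bochner_integral :: "'b measure \<Rightarrow> ('b \<Rightarrow> 'a::real_normed_vector) \<Rightarrow> 'a" where
  "strong_bochner_integral M f = (THE x. has_strong_bochner_integral M f x)"

definition L1_space :: "'b measure \<Rightarrow> ('b \<Rightarrow> 'a::real_normed_vector) set" where
  "L1_space M = {f. \<exists>x. has_strong_bochner_integral M f x}"

definition L1_bounded :: "'b measure \<Rightarrow> ('b \<Rightarrow> 'a::real_normed_vector) set \<Rightarrow> bool" where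
  "L1_bounded M G \<longleftrightarrow> (\<exists>C::real. \<forall>g\<in>G. (\<integral>\<^sup>+y. ennreal (norm (g y)) \<partial>M) \<le> ennreal C)"

section \<open>The dual unit ball and the support map\<close>

typedef (overloaded) 'a dual_ball = "cball 0 1 :: ('a::real_normed_vector \<Rightarrow>\<^sub>L real) set"
  morphisms functional_of Abs_dual_ball
  by (rule exI[of _ 0]) simp

instantiation dual_ball :: (real_normed_vector) metric_space
begin

definition dist_dual_ball :: "'a dual_ball \<Rightarrow> 'a dual_ball \<Rightarrow> real" where
  "dist_dual_ball u v = dist (functional_of u) (functional_of v)"

definition uniformity_dual_ball :: "('a dual_ball \<times> 'a dual_ball) filter" where
  "uniformity_dual_ball = (INF e\<in>{0<..}. principal {(x, y). dist x y < e})"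

definition open_dual_ball :: "'a dual_ball set \<Rightarrow> bool" where
  "open_dual_ball S = (\<forall>x\<in>S. \<forall>\<^sub>F (x', y) in uniformity. x' = x \<longrightarrow> y \<in> S)"

instance
proof
  fix x y z :: "'a dual_ball"
  show "dist x y = 0 \<longleftrightarrow> x = y"
    by (simp add: dist_dual_ball_def functional_of_inject)
  show "dist x y \<le> dist x z + dist y z"
    unfolding dist_dual_ball_def by (rule dist_triangle2)
qed (simp_all add: uniformity_dual_ball_def open_dual_ball_def)

end

definition values_at :: "('b \<Rightarrow> 'a) set \<Rightarrow> 'b \<Rightarrow> 'a set" where
  "values_at G t = (\<lambda>g. g t) ` G"

text \<open>
  Meaningful at those \<open>t\<close> for which \<open>values_at G t\<close> is bounded (see the lemma below), and
  arbitrary elsewhere.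
\<close>

definition support_map :: "('b \<Rightarrow> 'a::real_normed_vector) set \<Rightarrow> 'b \<Rightarrow> 'a dual_ball \<Rightarrow>\<^sub>C real" where
  "support_map G t = Bcontfun (\<lambda>u. SUP g\<in>G. blinfun_apply (functional_of u) (g t))"

lemma apply_support_map:
  fixes G :: "('b \<Rightarrow> 'a::real_normed_vector) set"
  assumes "G \<noteq> {}" and "bounded (values_at G t)"
  shows "apply_bcontfun (support_map G t) u = (SUP g\<in>G. blinfun_apply (functional_of u) (g t))"
proof -
  let ?f = "\<lambda>u::'a dual_ball. SUP g\<in>G. blinfun_apply (functional_of u) (g t)"
  obtain C where C: "\<And>g. g \<in> G \<Longrightarrow> norm (g t) \<le> C"
    using assms(2) by (auto simp: bounded_iff values_at_def)
  have C0: "0 \<le> C"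
    using C assms(1) norm_ge_zero order_trans by blast
  have le: "\<bar>blinfun_apply \<phi> (g t)\<bar> \<le> norm \<phi> * C" if "g \<in> G" for g and \<phi> :: "'a \<Rightarrow>\<^sub>L real"
    using norm_blinfun[of \<phi> "g t"] mult_left_mono[OF C[OF that] norm_ge_zero[of \<phi>]] by simp
  have bdd: "bdd_above ((\<lambda>g. blinfun_apply \<phi> (g t)) ` G)" for \<phi> :: "'a \<Rightarrow>\<^sub>L real"
    by (rule bdd_aboveI[of _ "norm \<phi> * C"]) (auto intro!: abs_le_D1[OF le])
  have one: "?f u \<le> ?f v + C * dist u v" for u v
  proof (rule cSUP_least[OF assms(1)])
    fix g assume g: "g \<in> G"
    have "blinfun_apply (functional_of u) (g t) =
        blinfun_apply (functional_of v) (g t) + blinfun_apply (functional_of u - functional_of v) (g t)"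
      by (simp add: blinfun.diff_left)
    also have "\<dots> \<le> ?f v + norm (functional_of u - functional_of v) * C"
      using cSUP_upper[OF g bdd, of "functional_of v"] le[OF g, of "functional_of u - functional_of v"]
      by linarith
    finally show "blinfun_apply (functional_of u) (g t) \<le> ?f v + C * dist u v"
      by (simp add: dist_dual_ball_def dist_norm mult.commute)
  qed
  have lip: "dist (?f u) (?f v) \<le> C * dist u v" for u v
    using one[of u v] one[of v u] by (simp add: dist_real_def dist_commute abs_le_iff)
  have "C-lipschitz_on UNIV ?f"
    by (rule lipschitz_onI[OF lip C0])
  then have "continuous_on UNIV ?f"
    by (rule lipschitz_on_continuous_on)
  moreover have "bounded (range ?f)"
  proof -
    have n1: "norm (functional_of u) \<le> 1" for u :: "'a dual_ball"
      using functional_of[of u] by simp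
    have "\<bar>blinfun_apply (functional_of u) (g t)\<bar> \<le> C" if "g \<in> G" for g u
      using le[OF that, of "functional_of u"] mult_right_mono[OF n1[of u] C0] by simp
    then have "\<bar>?f u\<bar> \<le> C" for u
      by (intro cSup_abs_le) (use assms(1) in auto)
    then show ?thesis
      by (auto simp: bounded_iff)
  qed
  ultimately have "?f \<in> bcontfun"
    by (simp add: bcontfun_def)
  then show ?thesis
    by (simp add: support_map_def Bcontfun_inverse)
qed

end

theory Submission
  imports Defs
begin

text \<open>
  By Hahn-Banach the support map determines the sets \<open>G(s)\<close> up to closed convex hulls, and the
  sup-norm dominates the one-sided Hausdorff distances of these hulls. Strong measurability of the
  support map hence cuts the interval, up to a set on which \<open>\<psi>\<close> has small integral, into finitely
  many measurable cells \<open>E\<^sub>i\<close> on which \<open>G(s)\<close> is almost constant, say close to \<open>G(s\<^sub>i)\<close>. Testing with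
  functionals shows that the integral of \<open>G\<close> lies near \<open>\<Sum>\<^sub>i |E\<^sub>i| co G(s\<^sub>i)\<close>. Convexity and \<open>\<mu> {0} = 0\<close>
  (if \<open>\<Sum>\<^sub>i |E\<^sub>i| \<le> 1\<close>), or else sublinearity, bounds \<open>\<mu>\<close> of that sum by \<open>\<Sum>\<^sub>i |E\<^sub>i| \<mu>(G(s\<^sub>i))\<close>. The
  errors are controlled because a convex \<open>\<mu>\<close> is Lipschitz for the Hausdorff distance on each ball.
\<close>

section \<open>Separation by functionals of norm at most one\<close>

definition sublinear_functional :: "('a::real_vector \<Rightarrow> real) \<Rightarrow> bool" where
  "sublinear_functional q \<longleftrightarrow>
     (\<forall>x y. q (x + y) \<le> q x + q y) \<and> (\<forall>r\<ge>0. \<forall>x. q (r *\<^sub>R x) \<le> r * q x)"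

lemma sublinear_functionalI:
  assumes "\<And>x y. q (x + y) \<le> q x + q y" and "\<And>r x. 0 \<le> r \<Longrightarrow> q (r *\<^sub>R x) \<le> r * q x"
  shows "sublinear_functional q"
  using assms by (simp add: sublinear_functional_def)

lemma sublinear_functional_add:
  "sublinear_functional q \<Longrightarrow> q (x + y) \<le> q x + q y"
  by (simp add: sublinear_functional_def)

lemma sublinear_functional_0: "sublinear_functional q \<Longrightarrow> q 0 = 0"
proof -
  assume q: "sublinear_functional q"
  have "q (0 *\<^sub>R 0) \<le> 0 * q 0"
    using q unfolding sublinear_functional_def by blast
  moreover have "q (0 + 0) \<le> q 0 + q 0"
    using q unfolding sublinear_functional_def by blast
  ultimately show "q 0 = 0" by simp
qed

text \<open>The definition asks for only one inequality, which infima inherit easily. Applying it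
  with factor \<open>inverse r\<close> at the point \<open>r *\<^sub>R x\<close> gives the reverse
  one.\<close>

lemma sublinear_functional_scale:
  assumes q: "sublinear_functional q" and r: "0 \<le> r"
  shows "q (r *\<^sub>R x) = r * q x"
proof (cases "r = 0")
  case True
  then show ?thesis by (simp add: sublinear_functional_0[OF q])
next
  case False
  with r have r: "0 < r" by simp
  have "q (inverse r *\<^sub>R (r *\<^sub>R x)) \<le> inverse r * q (r *\<^sub>R x)"
    using q r unfolding sublinear_functional_def by (meson inverse_nonnegative_iff_nonnegative less_imp_le)
  then have "r * q x \<le> q (r *\<^sub>R x)"
    using r by (simp add: field_simps)
  moreover have "q (r *\<^sub>R x) \<le> r * q x"
    using q r unfolding sublinear_functional_def by simp
  ultimately show ?thesis by simp
qed

lemma sublinear_functional_neg: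
  assumes q: "sublinear_functional q"
  shows "- q (- x) \<le> q x"
  using sublinear_functional_add[OF q, of x "- x"] sublinear_functional_0[OF q] by simp

text \<open>Subadditivity is where the chain matters: of two members \<open>q\<close> and
  \<open>q'\<close> the smaller one, used at both \<open>x\<close> and \<open>y\<close>, bounds the
  infimum at \<open>x + y\<close> by \<open>q x + q' y\<close>. The infima over \<open>q\<close> and
  \<open>q'\<close> can then be taken separately.\<close>

lemma sublinear_functional_INF:
  assumes "Q \<noteq> {}" and Q: "\<And>q. q \<in> Q \<Longrightarrow> sublinear_functional q"
    and chain: "\<And>q q'. q \<in> Q \<Longrightarrow> q' \<in> Q \<Longrightarrow> q \<le> q' \<or> q' \<le> q"
    and bdd: "\<And>x. bdd_below ((\<lambda>q. q x) ` Q)"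
  shows "sublinear_functional (\<lambda>x. INF q\<in>Q. q x)"
proof (rule sublinear_functionalI)
  let ?u = "\<lambda>x. INF q\<in>Q. q x"
  have low: "?u x \<le> q x" if "q \<in> Q" for q x
    by (rule cINF_lower[OF bdd that])
  fix x y
  have *: "?u (x + y) \<le> q x + q' y" if qq: "q \<in> Q" "q' \<in> Q" for q q'
  proof -
    obtain p where p: "p \<in> Q" "p \<le> q" "p \<le> q'"
      using chain[OF qq] qq by (meson order_refl)
    have "?u (x + y) \<le> p x + p y"
      using low[OF p(1), of "x + y"] sublinear_functional_add[OF Q[OF p(1)], of x y] by simp
    also have "\<dots> \<le> q x + q' y"
      using p by (simp add: le_fun_def add_mono)
    finally show ?thesis .
  qed
  have "?u (x + y) - q x \<le> ?u y" if "q \<in> Q" for q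
    by (rule cINF_greatest[OF \<open>Q \<noteq> {}\<close>]) (use *[OF that] in \<open>simp add: algebra_simps\<close>)
  then have "?u (x + y) - ?u y \<le> ?u x"
    by (intro cINF_greatest[OF \<open>Q \<noteq> {}\<close>]) (simp add: algebra_simps)
  then show "?u (x + y) \<le> ?u x + ?u y" by simp
next
  let ?u = "\<lambda>x. INF q\<in>Q. q x"
  have low: "?u x \<le> q x" if "q \<in> Q" for q x
    by (rule cINF_lower[OF bdd that])
  fix r :: real and x assume r: "0 \<le> r"
  have *: "?u (r *\<^sub>R x) \<le> r * q x" if "q \<in> Q" for q
    using low[OF that, of "r *\<^sub>R x"] by (simp add: sublinear_functional_scale[OF Q[OF that] r])
  show "?u (r *\<^sub>R x) \<le> r * ?u x"
  proof (cases "r = 0")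
    case True
    then show ?thesis using * \<open>Q \<noteq> {}\<close> by auto
  next
    case False
    with r have r: "0 < r" by simp
    have "?u (r *\<^sub>R x) / r \<le> ?u x"
      by (rule cINF_greatest[OF \<open>Q \<noteq> {}\<close>]) (use * r in \<open>simp add: field_simps\<close>)
    then show ?thesis using r by (simp add: field_simps)
  qed
qed

text \<open>A sublinear \<open>q\<close> that is minimal equals each of its tilts \<open>h\<close>, which makes it additive.\<close>

lemma sublinear_functional_tilt:
  fixes x :: "'a::real_vector"
  assumes q: "sublinear_functional q"
  defines "h \<equiv> \<lambda>y. INF r\<in>{0..}. q (y + r *\<^sub>R x) - r * q x"
  shows "sublinear_functional h" and "h \<le> q" and "h y + q x \<le> q (y + x)"
proof -
  have bdd: "bdd_below ((\<lambda>r. q (y + r *\<^sub>R x) - r * q x) ` {0..})" for y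
  proof (rule bdd_belowI2)
    fix r :: real assume "r \<in> {0..}"
    then have "r * q x = q ((y + r *\<^sub>R x) + - y)"
      by (simp add: sublinear_functional_scale[OF q])
    also have "\<dots> \<le> q (y + r *\<^sub>R x) + q (- y)"
      by (rule sublinear_functional_add[OF q])
    finally show "- q (- y) \<le> q (y + r *\<^sub>R x) - r * q x" by simp
  qed
  have low: "h y \<le> q (y + r *\<^sub>R x) - r * q x" if "0 \<le> r" for y r
    unfolding h_def by (rule cINF_lower[OF bdd]) (use that in simp)
  have greatest: "b \<le> h y" if "\<And>r. 0 \<le> r \<Longrightarrow> b \<le> q (y + r *\<^sub>R x) - r * q x" for b y
    unfolding h_def by (rule cINF_greatest) (use that in auto)
  show "h \<le> q"
    using low[of 0] by (simp add: le_fun_def)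
  show "h y + q x \<le> q (y + x)"
    using low[of 1 y] by simp
  show "sublinear_functional h"
  proof (rule sublinear_functionalI)
    fix y z
    have *: "h (y + z) \<le> (q (y + r *\<^sub>R x) - r * q x) + (q (z + s *\<^sub>R x) - s * q x)"
      if "0 \<le> r" "0 \<le> s" for r s
    proof -
      \<comment> \<open>Parameters add: \<open>r\<close> for \<open>y\<close> and \<open>s\<close>
        for \<open>z\<close> are answered by \<open>r + s\<close> for \<open>y + z\<close>.\<close>
      have "h (y + z) \<le> q ((y + r *\<^sub>R x) + (z + s *\<^sub>R x)) - (r + s) * q x"
        using low[of "r + s" "y + z"] that by (simp add: algebra_simps)
      also have "\<dots> \<le> q (y + r *\<^sub>R x) + q (z + s *\<^sub>R x) - (r + s) * q x"
        using sublinear_functional_add[OF q] by simp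
      finally show ?thesis by (simp add: algebra_simps)
    qed
    have "h (y + z) - (q (y + r *\<^sub>R x) - r * q x) \<le> h z" if "0 \<le> r" for r
      by (rule greatest) (use *[OF that] in \<open>simp add: algebra_simps\<close>)
    then have "h (y + z) - h z \<le> h y"
      by (intro greatest) (simp add: algebra_simps)
    then show "h (y + z) \<le> h y + h z" by simp
  next
    fix s :: real and y assume s: "0 \<le> s"
    show "h (s *\<^sub>R y) \<le> s * h y"
    proof (cases "s = 0")
      case True
      then show ?thesis using low[of 0 0] by (simp add: sublinear_functional_0[OF q])
    next
      case False
      with s have s: "0 < s" by simp
      have "h (s *\<^sub>R y) \<le> s * (q (y + r *\<^sub>R x) - r * q x)" if "0 \<le> r" for r
      proof -
        have "h (s *\<^sub>R y) \<le> q (s *\<^sub>R (y + r *\<^sub>R x)) - (s * r) * q x"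
          using low[of "s * r" "s *\<^sub>R y"] s that by (simp add: scaleR_add_right)
        then show ?thesis
          using s by (simp only: sublinear_functional_scale[OF q less_imp_le[OF s]] right_diff_distrib mult.assoc)
      qed
      then have "h (s *\<^sub>R y) / s \<le> h y"
        by (intro greatest) (use s in \<open>simp add: field_simps\<close>)
      then show ?thesis using s by (simp add: field_simps)
    qed
  qed
qed

text \<open>Zorn's lemma provides a minimal sublinear functional below \<open>p\<close>. Coinciding
  with its tilts, it is additive, hence odd, which extends homogeneity to negative scalars.\<close>

theorem Hahn_Banach_sublinear:
  fixes p :: "'a::real_vector \<Rightarrow> real"
  assumes p: "sublinear_functional p"
  obtains f where "linear f" and "f \<le> p"
proof -
  define A where "A = {q. sublinear_functional q \<and> q \<le> p}"
  \<comment> \<open>The order is reversed: maximality in Zorn's lemma becomes minimality of the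
    functional, and a chain is bounded by its pointwise infimum.\<close>
  let ?P = "\<lambda>a b :: 'a \<Rightarrow> real. b \<le> a"
  have "\<exists>m\<in>A. \<forall>q\<in>A. q \<le> m \<longrightarrow> q = m"
  proof (rule predicate_Zorn)
    show "partial_order_on A (relation_of ?P A)"
      by (rule partial_order_on_relation_ofI) auto
    fix C assume C: "C \<in> Chains (relation_of ?P A)"
    show "\<exists>u\<in>A. \<forall>a\<in>C. u \<le> a"
    proof (cases "C = {}")
      case True
      then show ?thesis using p by (auto simp: A_def)
    next
      case False
      have CA: "sublinear_functional q" "q \<le> p" if "q \<in> C" for q
        using Chains_relation_of[OF C] that by (auto simp: A_def)
      have chain: "q \<le> q' \<or> q' \<le> q" if "q \<in> C" "q' \<in> C" for q q'
        using C that by (auto simp: Chains_def relation_of_def)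
      have bdd: "bdd_below ((\<lambda>q. q x) ` C)" for x
      proof (rule bdd_belowI2)
        fix q assume q: "q \<in> C"
        \<comment> \<open>A lower bound common to all members of the chain, obtained from
          \<open>q \<le> p\<close> at \<open>- x\<close>.\<close>
        show "- p (- x) \<le> q x"
          using sublinear_functional_neg[OF CA(1)[OF q], of x] le_funD[OF CA(2)[OF q], of "- x"]
          by linarith
      qed
      let ?u = "\<lambda>x. INF q\<in>C. q x"
      have low: "?u \<le> q" if "q \<in> C" for q
        unfolding le_fun_def by (intro allI cINF_lower[OF bdd that])
      have "sublinear_functional ?u"
        by (rule sublinear_functional_INF[OF False CA(1) chain bdd])
      moreover have "?u \<le> p"
        using False low CA(2) by (meson all_not_in_conv order_trans)
      ultimately show ?thesis
        unfolding A_def using low by blast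
    qed
  qed
  then obtain f where f: "sublinear_functional f" "f \<le> p"
    and min: "\<And>q. sublinear_functional q \<Longrightarrow> q \<le> f \<Longrightarrow> q = f"
    unfolding A_def by (smt (verit) mem_Collect_eq order_trans)
  have add: "f (y + x) = f y + f x" for x y
  proof (rule antisym)
    show "f (y + x) \<le> f y + f x"
      by (rule sublinear_functional_add[OF f(1)])
    show "f y + f x \<le> f (y + x)"
      using sublinear_functional_tilt(3)[OF f(1), of y x]
        fun_cong[OF min[OF sublinear_functional_tilt(1,2)[OF f(1), of x]], of y]
      by simp
  qed
  have neg: "f (- x) = - f x" for x
    using add[of x "- x"] sublinear_functional_0[OF f(1)] by simp
  have "linear f"
  proof (rule linearI)
    fix r :: real and x
    show "f (r *\<^sub>R x) = r *\<^sub>R f x"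
    proof (cases "0 \<le> r")
      case True
      then show ?thesis by (simp add: sublinear_functional_scale[OF f(1)])
    next
      case False
      then have "f ((- r) *\<^sub>R x) = (- r) * f x"
        by (intro sublinear_functional_scale[OF f(1)]) simp
      then show ?thesis by (simp add: neg)
    qed
  qed (rule add)
  then show ?thesis using f(2) that by blast
qed

text \<open>A linear functional below the auxiliary \<open>p\<close> is dominated by the norm and is
  at most \<open>- d\<close> at every \<open>x - c\<close>, so its negative separates. That the gap
  is the full distance turns separation into a quantitative tool: a distance to a convex set can be
  estimated by testing with one functional.\<close>

theorem separating_functional_infdist:
  fixes C :: "'a::real_normed_vector set"
  assumes C: "convex C" "C \<noteq> {}"
  obtains \<phi> :: "'a \<Rightarrow>\<^sub>L real"
  where "norm \<phi> \<le> 1" and "\<And>c. c \<in> C \<Longrightarrow> blinfun_apply \<phi> c + infdist x C \<le> blinfun_apply \<phi> x"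
proof -
  define d where "d = infdist x C"
  \<comment> \<open>The largest sublinear functional below the norm that is at most \<open>- d\<close> on \<open>x - C\<close>.\<close>
  define p where "p = (\<lambda>y. INF (r, c)\<in>{0..} \<times> C. norm (y + r *\<^sub>R (c - x)) - r * d)"
  have ne: "{0::real..} \<times> C \<noteq> {}" using C(2) by auto
  have bdd: "bdd_below ((\<lambda>(r, c). norm (y + r *\<^sub>R (c - x)) - r * d) ` ({0..} \<times> C))" for y
  proof (rule bdd_belowI2)
    fix z assume "z \<in> {0::real..} \<times> C"
    then obtain r c where z: "z = (r, c)" and r: "0 \<le> r" and c: "c \<in> C"
      by auto
    \<comment> \<open>Since \<open>d\<close> is at most \<open>norm (c - x)\<close>, the norm term
      absorbs the negative term up to \<open>norm y\<close>, so the infimum defining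
      \<open>p\<close> is finite.\<close>
    have "r * d \<le> r * norm (c - x)"
      using infdist_le[OF c, of x] r by (auto simp: d_def dist_norm norm_minus_commute intro: mult_left_mono)
    also have "\<dots> = norm (r *\<^sub>R (c - x))" using r by simp
    also have "\<dots> \<le> norm (y + r *\<^sub>R (c - x)) + norm y"
      by (metis add_diff_cancel_left' norm_triangle_sub norm_triangle_ineq4)
    finally show "- norm y \<le> (case z of (r, c) \<Rightarrow> norm (y + r *\<^sub>R (c - x)) - r * d)"
      by (simp add: z)
  qed
  have low: "p y \<le> norm (y + r *\<^sub>R (c - x)) - r * d" if "0 \<le> r" "c \<in> C" for y r c
    unfolding p_def using cINF_lower[OF bdd, of "(r, c)" y] that by simp
  have greatest: "b \<le> p y"
    if "\<And>r c. 0 \<le> r \<Longrightarrow> c \<in> C \<Longrightarrow> b \<le> norm (y + r *\<^sub>R (c - x)) - r * d" for b y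
    unfolding p_def by (rule cINF_greatest[OF ne]) (use that in auto)
  have "sublinear_functional p"
  proof (rule sublinear_functionalI)
    fix y z
    have *: "p (y + z) \<le> (norm (y + r *\<^sub>R (c - x)) - r * d) + (norm (z + s *\<^sub>R (e - x)) - s * d)"
      if rs: "0 \<le> r" "c \<in> C" "0 \<le> s" "e \<in> C" for r c s e
    proof -
      \<comment> \<open>Convexity of \<open>C\<close> merges the two weighted points into one point
        \<open>u\<close> with weight \<open>r + s\<close>, which is again admissible in the
        infimum.\<close>
      obtain u where u: "u \<in> C" "r *\<^sub>R c + s *\<^sub>R e = (r + s) *\<^sub>R u"
      proof (cases "r + s = 0")
        case True
        then have "r = 0" "s = 0" using rs by auto
        then show ?thesis using rs(2) by (intro that) auto
      next
        case False
        then have "(r / (r + s)) *\<^sub>R c + (s / (r + s)) *\<^sub>R e \<in> C"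
          using rs by (intro convexD[OF C(1)]) (auto simp flip: add_divide_distrib)
        moreover have "(r + s) *\<^sub>R ((r / (r + s)) *\<^sub>R c + (s / (r + s)) *\<^sub>R e) = r *\<^sub>R c + s *\<^sub>R e"
          using False by (simp add: scaleR_add_right)
        ultimately show ?thesis by (intro that) auto
      qed
      have "p (y + z) \<le> norm ((y + z) + (r + s) *\<^sub>R (u - x)) - (r + s) * d"
        using rs u by (intro low) auto
      also have "(y + z) + (r + s) *\<^sub>R (u - x) = (y + r *\<^sub>R (c - x)) + (z + s *\<^sub>R (e - x))"
        using u(2) by (simp add: algebra_simps)
      also have "norm \<dots> \<le> norm (y + r *\<^sub>R (c - x)) + norm (z + s *\<^sub>R (e - x))"
        by (rule norm_triangle_ineq)
      finally show ?thesis by (simp add: algebra_simps)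
    qed
    have "p (y + z) - (norm (y + r *\<^sub>R (c - x)) - r * d) \<le> p z" if "0 \<le> r" "c \<in> C" for r c
      by (rule greatest) (use *[OF that] in \<open>simp add: algebra_simps\<close>)
    then have "p (y + z) - p z \<le> p y"
      by (intro greatest) (simp add: algebra_simps)
    then show "p (y + z) \<le> p y + p z" by simp
  next
    fix s :: real and y assume s: "0 \<le> s"
    have *: "p (s *\<^sub>R y) \<le> s * (norm (y + r *\<^sub>R (c - x)) - r * d)" if "0 \<le> r" "c \<in> C" for r c
    proof -
      have "p (s *\<^sub>R y) \<le> norm (s *\<^sub>R (y + r *\<^sub>R (c - x))) - (s * r) * d"
        using low[of "s * r" c "s *\<^sub>R y"] s that by (simp add: scaleR_add_right)
      also have "\<dots> = s * (norm (y + r *\<^sub>R (c - x)) - r * d)"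
        using s by (simp only: norm_scaleR right_diff_distrib mult.assoc abs_of_nonneg)
      finally show ?thesis .
    qed
    show "p (s *\<^sub>R y) \<le> s * p y"
    proof (cases "s = 0")
      case True
      then show ?thesis using * C(2) by auto
    next
      case False
      with s have s: "0 < s" by simp
      have "p (s *\<^sub>R y) / s \<le> p y"
        by (rule greatest) (use * s in \<open>simp add: field_simps\<close>)
      then show ?thesis using s by (simp add: field_simps)
    qed
  qed
  then obtain f where f: "linear f" "f \<le> p"
    by (rule Hahn_Banach_sublinear)
  obtain c0 where c0: "c0 \<in> C" using C(2) by blast
  have f_le: "f y \<le> norm (y + r *\<^sub>R (c - x)) - r * d" if "0 \<le> r" "c \<in> C" for y r c
    using f(2) low[OF that, of y] by (auto simp: le_fun_def intro: order_trans)
  have f_norm: "\<bar>f y\<bar> \<le> norm y" for y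
    using f_le[of 0 c0 y] f_le[of 0 c0 "- y"] c0 by (simp add: linear_neg[OF f(1)] abs_le_iff)
  have bl: "bounded_linear (\<lambda>y. - f y)"
    by (rule bounded_linear_intro[where K = 1])
      (use f(1) f_norm in \<open>auto simp: linear_add linear_scale\<close>)
  define \<phi> where "\<phi> = Blinfun (\<lambda>y. - f y)"
  have \<phi>: "blinfun_apply \<phi> y = - f y" for y
    unfolding \<phi>_def by (simp add: bounded_linear_Blinfun_apply[OF bl])
  show ?thesis
  proof (rule that)
    show "norm \<phi> \<le> 1"
      by (rule norm_blinfun_bound) (use f_norm \<phi> in auto)
    fix c assume c: "c \<in> C"
    \<comment> \<open>At the point \<open>x - c\<close> with \<open>r = 1\<close> the norm term
      vanishes.\<close>
    have "f (x - c) \<le> - d"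
      using f_le[of 1 c "x - c"] c by simp
    then show "blinfun_apply \<phi> c + infdist x C \<le> blinfun_apply \<phi> x"
      by (simp add: \<phi> linear_diff[OF f(1)] d_def)
  qed
qed

section \<open>Strong Bochner integrals on complete measure spaces\<close>

lemma (in complete_measure) borel_measurable_cong_AE:
  assumes f: "f \<in> borel_measurable M" and ae: "AE x in M. f x = g x"
  shows "g \<in> borel_measurable M"
proof (rule measurableI)
  fix A :: "'b set" assume A: "A \<in> sets borel"
  show "g -` A \<inter> space M \<in> sets M"
  proof (rule in_sets_AE)
    show "AE x in M. x \<in> f -` A \<inter> space M \<longleftrightarrow> x \<in> g -` A \<inter> space M"
      using ae by eventually_elim auto
    show "f -` A \<inter> space M \<in> sets M"
      by (rule measurable_sets[OF f A])
  qed auto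
qed simp

text \<open>Setting all functions to zero on a null set that contains the exceptional points makes
  the convergence hold everywhere; completeness then carries measurability back to
  \<open>f\<close>.\<close>

lemma (in complete_measure) borel_measurable_LIMSEQ_AE:
  fixes f :: "'a \<Rightarrow> real"
  assumes u: "\<And>i. u i \<in> borel_measurable M" and lim: "AE x in M. (\<lambda>i. u i x) \<longlonglongrightarrow> f x"
  shows "f \<in> borel_measurable M"
proof -
  obtain N where N: "{x \<in> space M. \<not> (\<lambda>i. u i x) \<longlonglongrightarrow> f x} \<subseteq> N" "N \<in> null_sets M"
    using lim by (auto elim: AE_E simp: null_sets_def)
  define h where "h x = indicator (space M - N) x * f x" for x
  have "h \<in> borel_measurable M"
  proof (rule borel_measurable_LIMSEQ_real)
    show "(\<lambda>x. indicator (space M - N) x * u i x) \<in> borel_measurable M" for i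
      using u N(2) by (intro borel_measurable_times borel_measurable_indicator) auto
    show "(\<lambda>i. indicator (space M - N) x * u i x) \<longlonglongrightarrow> h x" if "x \<in> space M" for x
      using N(1) that by (cases "x \<in> N") (auto simp: h_def)
  qed
  moreover have "AE x in M. h x = f x"
    using AE_not_in[OF N(2)] AE_space by eventually_elim (simp add: h_def)
  ultimately show ?thesis
    by (rule borel_measurable_cong_AE)
qed

lemma (in complete_measure) complete_measure_restrict_space:
  assumes "S \<in> sets M"
  shows "complete_measure (restrict_space M S)"
proof
  fix A B assume "B \<subseteq> A" "A \<in> null_sets (restrict_space M S)"
  with assms have A: "B \<subseteq> S" "B \<in> sets M"
    using complete[of B A] by (auto simp: null_sets_restrict_space)
  have "S \<inter> space M \<in> sets M" using assms by auto
  then show "B \<in> sets (restrict_space M S)"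
    using A by (simp add: sets_restrict_space_iff)
qed

lemma simple_function_restrict_space:
  assumes f: "simple_function M f" and S: "S \<in> sets M"
  shows "simple_function (restrict_space M S) f"
  unfolding simple_function_def
proof
  have sp: "space (restrict_space M S) = S"
    using sets.sets_into_space[OF S] by (auto simp: space_restrict_space)
  show "finite (f ` space (restrict_space M S))"
    using simple_functionD(1)[OF f] sets.sets_into_space[OF S]
    by (auto simp: sp intro: finite_subset[OF image_mono])
  show "\<forall>x\<in>f ` space (restrict_space M S).
      f -` {x} \<inter> space (restrict_space M S) \<in> sets (restrict_space M S)"
  proof
    fix x
    have "f -` {x} \<inter> S = (f -` {x} \<inter> space M) \<inter> S"
      using sets.sets_into_space[OF S] by auto
    also have "\<dots> \<in> sets M"
      using simple_functionD(2)[OF f] S by auto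
    finally show "f -` {x} \<inter> space (restrict_space M S) \<in> sets (restrict_space M S)"
      using S sets.sets_into_space[OF S] by (auto simp: sp sets_restrict_space_iff)
  qed
qed

lemma simple_bochner_integrable_restrict_space:
  assumes f: "Bochner_Integration.simple_bochner_integrable M f" and S: "S \<in> sets M"
  shows "Bochner_Integration.simple_bochner_integrable (restrict_space M S) f"
  using f
proof cases
  case 1
  have sp: "space (restrict_space M S) = S"
    using sets.sets_into_space[OF S] by (auto simp: space_restrict_space)
  have meas: "{y \<in> space M. f y \<noteq> 0} \<in> sets M"
    using measurable_simple_function[OF 1(1)] by measurable
  have "emeasure (restrict_space M S) {y \<in> S. f y \<noteq> 0} = emeasure M {y \<in> S. f y \<noteq> 0}"
    using S sets.sets_into_space[OF S] by (intro emeasure_restrict_space) auto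
  also have "\<dots> \<le> emeasure M {y \<in> space M. f y \<noteq> 0}"
    using sets.sets_into_space[OF S] by (intro emeasure_mono meas) auto
  finally have "emeasure (restrict_space M S) {y \<in> S. f y \<noteq> 0} \<noteq> \<infinity>"
    using 1(2) by (auto simp: top_unique)
  then show ?thesis
    by (intro simple_bochner_integrable.intros simple_function_restrict_space[OF 1(1) S]) (simp add: sp)
qed

lemma AE_restrict_spaceI:
  assumes "AE x in M. P x" and "S \<in> sets M"
  shows "AE x in restrict_space M S. P x"
  using assms by (subst AE_restrict_space_iff) auto

lemma strongly_measurable_restrict_space:
  assumes "strongly_measurable M f" and "S \<in> sets M"
  shows "strongly_measurable (restrict_space M S) f"
  using assms unfolding strongly_measurable_def
  by (blast intro: simple_function_restrict_space AE_restrict_spaceI)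

text \<open>Provides Borel measurability of scalar expressions such as
  \<open>norm (f x - s x)\<close> or \<open>blinfun_apply \<phi> (f x)\<close> without treating
  \<open>f\<close> as a Borel map. Along simple approximants the composite is simple, and continuity
  in the first argument passes to the limit.\<close>

lemma (in complete_measure) borel_measurable_strongly_measurable_compose:
  fixes p :: "'b::real_normed_vector \<Rightarrow> 'c \<Rightarrow> real"
  assumes f: "strongly_measurable M f" and s: "simple_function M s"
    and p: "\<And>y. continuous_on UNIV (\<lambda>x. p x y)"
  shows "(\<lambda>x. p (f x) (s x)) \<in> borel_measurable M"
proof -
  obtain u where u: "\<And>i. simple_function M (u i)" "AE x in M. (\<lambda>i. u i x) \<longlonglongrightarrow> f x"
    using f unfolding strongly_measurable_def by blast
  show ?thesis
  proof (rule borel_measurable_LIMSEQ_AE)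
    show "(\<lambda>x. p (u i x) (s x)) \<in> borel_measurable M" for i
      by (rule borel_measurable_simple_function[OF simple_function_compose2[OF u(1) s]])
    show "AE x in M. (\<lambda>i. p (u i x) (s x)) \<longlonglongrightarrow> p (f x) (s x)"
      using u(2)
    proof eventually_elim
      case (elim x)
      show ?case
        by (rule continuous_on_tendsto_compose[OF p elim]) auto
    qed
  qed
qed

section \<open>Strong Bochner integrals: restriction, scalarization and uniqueness\<close>

lemma (in complete_measure) simple_bochner_integral_dist_le:
  assumes f: "strongly_measurable M f"
    and s: "Bochner_Integration.simple_bochner_integrable M s"
    and t: "Bochner_Integration.simple_bochner_integrable M t"
  shows "ennreal (dist (Bochner_Integration.simple_bochner_integral M s)
      (Bochner_Integration.simple_bochner_integral M t))
    \<le> (\<integral>\<^sup>+x. ennreal (norm (f x - s x)) \<partial>M) + (\<integral>\<^sup>+x. ennreal (norm (f x - t x)) \<partial>M)"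
proof -
  have sf: "simple_function M s" "simple_function M t"
    using s t by (auto elim: simple_bochner_integrable.cases)
  have "(\<lambda>x. norm (f x - s x)) \<in> borel_measurable M" "(\<lambda>x. norm (f x - t x)) \<in> borel_measurable M"
    by (intro borel_measurable_strongly_measurable_compose[OF f, where p = "\<lambda>x y. norm (x - y)"] sf
        continuous_intros)+
  note [measurable] = this
  let ?d = "\<lambda>x. norm (s x - t x)"
  have st: "Bochner_Integration.simple_bochner_integrable M (\<lambda>x. s x - t x)"
    "Bochner_Integration.simple_bochner_integrable M ?d"
    using s t by (auto intro: simple_bochner_integrable_compose2)
  have "ennreal (dist (Bochner_Integration.simple_bochner_integral M s)
      (Bochner_Integration.simple_bochner_integral M t))
    \<le> ennreal (Bochner_Integration.simple_bochner_integral M ?d)"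
    using simple_bochner_integral_norm_bound[OF st(1)]
    by (intro ennreal_leI) (simp add: dist_norm simple_bochner_integral_diff[OF s t])
  also have "\<dots> = (\<integral>\<^sup>+x. ennreal (?d x) \<partial>M)"
    by (rule simple_bochner_integral_eq_nn_integral[OF st(2)]) simp
  also have "\<dots> \<le> (\<integral>\<^sup>+x. ennreal (norm (f x - s x)) + ennreal (norm (f x - t x)) \<partial>M)"
  proof (rule nn_integral_mono)
    fix x
    have "?d x \<le> norm (f x - s x) + norm (f x - t x)"
      using norm_triangle_ineq4[of "f x - t x" "f x - s x"] by (simp add: algebra_simps)
    then show "ennreal (?d x) \<le> ennreal (norm (f x - s x)) + ennreal (norm (f x - t x))"
      by (simp flip: ennreal_plus)
  qed
  also have "\<dots> = (\<integral>\<^sup>+x. ennreal (norm (f x - s x)) \<partial>M) + (\<integral>\<^sup>+x. ennreal (norm (f x - t x)) \<partial>M)"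
    by (rule nn_integral_add) auto
  finally show ?thesis .
qed

text \<open>Restriction to \<open>S\<close> can only decrease the approximation errors, so the same
  simple functions still approximate \<open>f\<close>. Their integrals over \<open>S\<close> form a
  Cauchy sequence, and completeness of the space supplies the new value.\<close>

lemma (in complete_measure) has_strong_bochner_integral_restrict_space:
  fixes f :: "'a \<Rightarrow> 'b::banach"
  assumes "has_strong_bochner_integral M f x" and S: "S \<in> sets M"
  shows "\<exists>y. has_strong_bochner_integral (restrict_space M S) f y"
proof -
  let ?R = "restrict_space M S"
  interpret R: complete_measure ?R
    by (rule complete_measure_restrict_space[OF S])
  obtain s where f: "strongly_measurable M f"
    and s: "\<And>i. Bochner_Integration.simple_bochner_integrable M (s i)"
    and lim: "(\<lambda>i. \<integral>\<^sup>+y. ennreal (norm (f y - s i y)) \<partial>M) \<longlonglongrightarrow> 0"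
    using assms(1) unfolding has_strong_bochner_integral_def by blast
  have fR: "strongly_measurable ?R f"
    by (rule strongly_measurable_restrict_space[OF f S])
  have sR: "Bochner_Integration.simple_bochner_integrable ?R (s i)" for i
    by (rule simple_bochner_integrable_restrict_space[OF s S])
  let ?S = "\<lambda>i. \<integral>\<^sup>+y. ennreal (norm (f y - s i y)) \<partial>?R"
  let ?I = "\<lambda>i. Bochner_Integration.simple_bochner_integral ?R (s i)"
  have le: "?S i \<le> (\<integral>\<^sup>+y. ennreal (norm (f y - s i y)) \<partial>M)" for i
    using S sets.sets_into_space[OF S]
    by (subst nn_integral_restrict_space)
      (auto intro!: nn_integral_mono simp: indicator_def Int_absorb2)
  have limR: "?S \<longlonglongrightarrow> 0"
    by (rule tendsto_sandwich[OF _ _ tendsto_const lim]) (use le in auto)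
  have "Cauchy ?I"
  proof (rule metric_CauchyI)
    fix e :: real assume e: "0 < e"
    then have "eventually (\<lambda>i. ?S i < ennreal (e / 2)) sequentially"
      by (intro order_tendstoD(2)[OF limR]) simp
    then obtain n where n: "\<And>i. n \<le> i \<Longrightarrow> ?S i < ennreal (e / 2)"
      by (auto simp: eventually_sequentially)
    have "dist (?I i) (?I j) < e" if "n \<le> i" "n \<le> j" for i j
    proof -
      have "ennreal (dist (?I i) (?I j)) \<le> ?S i + ?S j"
        by (rule R.simple_bochner_integral_dist_le[OF fR sR sR])
      also have "\<dots> < ennreal (e / 2) + ennreal (e / 2)"
        using that by (intro add_strict_mono n)
      also have "\<dots> = ennreal e"
        using e by (simp flip: ennreal_plus)
      finally show ?thesis using e by (simp add: ennreal_less_iff)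
    qed
    then show "\<exists>n. \<forall>i\<ge>n. \<forall>j\<ge>n. dist (?I i) (?I j) < e" by blast
  qed
  then obtain y where "?I \<longlonglongrightarrow> y"
    by (auto simp: Cauchy_convergent_iff convergent_def)
  then have "has_strong_bochner_integral ?R f y"
    unfolding has_strong_bochner_integral_def using fR sR limR by blast
  then show ?thesis ..
qed

text \<open>Composition with \<open>\<phi>\<close> multiplies approximation errors by at most
  \<open>norm \<phi>\<close> and commutes with simple integrals. Through this passage to scalar
  integrals, vector integrals can be estimated by monotonicity.\<close>

lemma (in complete_measure) has_bochner_integral_blinfun_apply:
  fixes \<phi> :: "'b::real_normed_vector \<Rightarrow>\<^sub>L real"
  assumes "has_strong_bochner_integral M f x"
  shows "has_bochner_integral M (\<lambda>s. blinfun_apply \<phi> (f s)) (blinfun_apply \<phi> x)"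
proof -
  obtain s where f: "strongly_measurable M f"
    and s: "\<And>i. Bochner_Integration.simple_bochner_integrable M (s i)"
    and lim: "(\<lambda>i. \<integral>\<^sup>+y. ennreal (norm (f y - s i y)) \<partial>M) \<longlonglongrightarrow> 0"
    and int: "(\<lambda>i. Bochner_Integration.simple_bochner_integral M (s i)) \<longlonglongrightarrow> x"
    using assms unfolding has_strong_bochner_integral_def by blast
  have sf: "simple_function M (s i)" for i
    using s[of i] by (auto elim: simple_bochner_integrable.cases)
  have meas: "(\<lambda>x. norm (f x - s i x)) \<in> borel_measurable M" for i
    by (intro borel_measurable_strongly_measurable_compose[OF f, where p = "\<lambda>x y. norm (x - y)"] sf
        continuous_intros)
  show ?thesis
  proof (rule has_bochner_integral.intros)
    show "(\<lambda>s. blinfun_apply \<phi> (f s)) \<in> borel_measurable M"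
      by (intro borel_measurable_strongly_measurable_compose[OF f simple_function_const,
            where p = "\<lambda>x y. blinfun_apply \<phi> x"] continuous_intros)
    show "Bochner_Integration.simple_bochner_integrable M (\<lambda>y. blinfun_apply \<phi> (s i y))" for i
      using simple_bochner_integrable_compose2[OF _ s s, of "\<lambda>x y. blinfun_apply \<phi> x"]
      by (simp add: blinfun.zero_right)
    have nb: "norm (blinfun_apply \<phi> (f y) - blinfun_apply \<phi> (s i y)) \<le> norm \<phi> * norm (f y - s i y)" for i y
      using norm_blinfun[of \<phi> "f y - s i y"] by (simp add: blinfun.diff_right)
    have le: "(\<integral>\<^sup>+y. ennreal (norm (blinfun_apply \<phi> (f y) - blinfun_apply \<phi> (s i y))) \<partial>M)
        \<le> ennreal (norm \<phi>) * (\<integral>\<^sup>+y. ennreal (norm (f y - s i y)) \<partial>M)" for i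
      using nb meas
      by (subst nn_integral_cmult[symmetric])
        (auto intro!: nn_integral_mono ennreal_leI simp flip: ennreal_mult)
    have "(\<lambda>i. ennreal (norm \<phi>) * (\<integral>\<^sup>+y. ennreal (norm (f y - s i y)) \<partial>M))
        \<longlonglongrightarrow> ennreal (norm \<phi>) * 0"
      by (intro ennreal_tendsto_cmult lim) simp
    then have lim': "(\<lambda>i. ennreal (norm \<phi>) * (\<integral>\<^sup>+y. ennreal (norm (f y - s i y)) \<partial>M)) \<longlonglongrightarrow> 0"
      by simp
    show "(\<lambda>i. \<integral>\<^sup>+y. ennreal (norm (blinfun_apply \<phi> (f y) - blinfun_apply \<phi> (s i y))) \<partial>M) \<longlonglongrightarrow> 0"
      by (rule tendsto_sandwich[OF _ _ tendsto_const lim']) (use le in auto)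
    have "Bochner_Integration.simple_bochner_integral M (\<lambda>y. blinfun_apply \<phi> (s i y))
        = blinfun_apply \<phi> (Bochner_Integration.simple_bochner_integral M (s i))" for i
      by (intro simple_bochner_integral_linear s bounded_linear.linear blinfun.bounded_linear_right)
    then show "(\<lambda>i. Bochner_Integration.simple_bochner_integral M (\<lambda>y. blinfun_apply \<phi> (s i y)))
        \<longlonglongrightarrow> blinfun_apply \<phi> x"
      using int by (simp add: tendsto_intros)
  qed
qed

text \<open>Two candidate values agree under every bounded functional, and a functional separating
  \<open>y\<close> from \<open>{x}\<close> by their full distance forces them to coincide.\<close>

lemma (in complete_measure) strong_bochner_integral_eq:
  assumes x: "has_strong_bochner_integral M f x"
  shows "strong_bochner_integral M f = x"
  unfolding strong_bochner_integral_def
proof (rule the_equality)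
  show "has_strong_bochner_integral M f x" by (rule x)
  fix y assume y: "has_strong_bochner_integral M f y"
  obtain \<phi> :: "'b \<Rightarrow>\<^sub>L real" where "blinfun_apply \<phi> x + infdist y {x} \<le> blinfun_apply \<phi> y"
    by (rule separating_functional_infdist[of "{x}" y]) auto
  moreover have "blinfun_apply \<phi> x = blinfun_apply \<phi> y"
    using has_bochner_integral_blinfun_apply[OF x] has_bochner_integral_blinfun_apply[OF y]
    by (rule has_bochner_integral_eq)
  ultimately show "y = x" by simp
qed

section \<open>Measures of non-property and set-valued approximation\<close>

lemma bounded_sets_scaleR: "B \<in> bounded_sets \<Longrightarrow> (*\<^sub>R) r ` B \<in> bounded_sets"
  by (auto simp: bounded_sets_def bounded_scaling)

lemma bounded_sets_plus:
  assumes "A \<in> bounded_sets" and "B \<in> bounded_sets"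
  shows "A + B \<in> bounded_sets"
proof -
  obtain a b where a: "\<And>x. x \<in> A \<Longrightarrow> norm x \<le> a" and b: "\<And>x. x \<in> B \<Longrightarrow> norm x \<le> b"
    using assms by (auto simp: bounded_sets_def bounded_iff)
  have "norm x \<le> a + b" if "x \<in> A + B" for x
    using that a b by (auto simp: set_plus_def intro: norm_triangle_mono)
  moreover have "A + B \<noteq> {}"
    using assms by (auto simp: bounded_sets_def set_plus_def)
  ultimately show ?thesis
    unfolding bounded_sets_def bounded_iff by blast
qed

lemma bounded_sets_sum:
  assumes "finite W" and "\<And>w. w \<in> W \<Longrightarrow> B w \<in> bounded_sets"
  shows "(\<Sum>w\<in>W. B w) \<in> bounded_sets"
  using assms
proof (induction W rule: finite_induct)
  case empty
  then show ?case by (simp add: set_zero bounded_sets_def)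
next
  case (insert w W)
  then show ?case by (simp add: bounded_sets_plus)
qed

lemma bounded_sets_convex_hull: "B \<in> bounded_sets \<Longrightarrow> convex hull B \<in> bounded_sets"
  by (auto simp: bounded_sets_def bounded_convex_hull)

lemma bounded_sets_cball: "0 \<le> r \<Longrightarrow> cball x r \<in> bounded_sets"
  by (simp add: bounded_sets_def)

lemma scaleR_image_plus:
  fixes A B :: "'a::real_vector set"
  shows "(*\<^sub>R) r ` (A + B) = (*\<^sub>R) r ` A + (*\<^sub>R) r ` B"
proof
  show "(*\<^sub>R) r ` (A + B) \<subseteq> (*\<^sub>R) r ` A + (*\<^sub>R) r ` B"
    by (auto simp: scaleR_add_right intro!: set_plus_intro elim!: set_plus_elim)
  show "(*\<^sub>R) r ` A + (*\<^sub>R) r ` B \<subseteq> (*\<^sub>R) r ` (A + B)"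
    by (auto simp flip: scaleR_add_right intro!: imageI set_plus_intro elim!: set_plus_elim)
qed

lemma scaleR_image_sum:
  fixes B :: "'b \<Rightarrow> 'a::real_vector set"
  assumes "finite W"
  shows "(*\<^sub>R) r ` (\<Sum>w\<in>W. B w) = (\<Sum>w\<in>W. (*\<^sub>R) r ` B w)"
  using assms by (induction W rule: finite_induct) (simp_all add: set_zero scaleR_image_plus)

lemma convex_nonproperty_measureD:
  assumes "convex_nonproperty_measure \<D> \<mu>"
  shows "B \<in> bounded_sets \<Longrightarrow> 0 \<le> \<mu> B"
    and "A \<in> bounded_sets \<Longrightarrow> B \<in> bounded_sets \<Longrightarrow> B \<subseteq> A \<Longrightarrow> \<mu> B \<le> \<mu> A"
    and "B \<in> bounded_sets \<Longrightarrow> \<mu> (convex hull B) = \<mu> B"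
    and "A \<in> bounded_sets \<Longrightarrow> B \<in> bounded_sets \<Longrightarrow> 0 \<le> r \<Longrightarrow> r \<le> 1 \<Longrightarrow>
      \<mu> ((*\<^sub>R) r ` A + (*\<^sub>R) (1 - r) ` B) \<le> r * \<mu> A + (1 - r) * \<mu> B"
  using assms unfolding convex_nonproperty_measure_def nonproperty_measure_def by simp_all

text \<open>The family is nonempty because it covers the space, and multiplying one of its nonempty
  members by 0 puts \<open>{0}\<close> into it.\<close>

lemma convex_nonproperty_measure_0:
  assumes D: "fundamental_subsemigroup \<D>" and \<mu>: "convex_nonproperty_measure \<D> \<mu>"
  shows "\<mu> {0} = 0"
proof -
  have "\<Union>\<D> = UNIV" "\<D> \<subseteq> closed_bounded_convex_sets"
    and scale: "\<And>A r. A \<in> \<D> \<Longrightarrow> (*\<^sub>R) r ` A \<in> \<D>"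
    using D unfolding fundamental_subsemigroup_def by auto
  moreover from this obtain A where A: "A \<in> \<D>" by blast
  ultimately have "A \<noteq> {}"
    by (auto simp: closed_bounded_convex_sets_def)
  have "(*\<^sub>R) 0 ` A = {0}"
    using \<open>A \<noteq> {}\<close> by auto
  with scale[OF A, of 0] have "closed_convex_hull {0} \<in> \<D>"
    by (simp add: closed_convex_hull_def)
  moreover have "{0} \<in> bounded_sets"
    by (simp add: bounded_sets_def)
  ultimately show ?thesis
    using \<mu> by (auto simp: convex_nonproperty_measure_def nonproperty_measure_def)
qed

text \<open>A point \<open>x\<close> within \<open>e\<close> of \<open>b\<close> is the convex
  combination of \<open>b\<close> with weight \<open>1 - e\<close> and of
  \<open>b + (x - b) / e\<close> with weight \<open>e\<close>. The latter point stays in a fixed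
  ball, so convexity of \<open>\<mu>\<close> charges the perturbation linearly in
  \<open>e\<close>.\<close>

lemma convex_nonproperty_measure_perturb:
  assumes \<mu>: "convex_nonproperty_measure \<D> \<mu>"
    and A: "A \<in> bounded_sets" "A \<subseteq> cball 0 r" and B: "B \<in> bounded_sets"
    and e: "0 < e" "e \<le> 1" and near: "\<And>x. x \<in> A \<Longrightarrow> infdist x B < e"
  shows "\<mu> A \<le> \<mu> B + e * \<mu> (cball 0 (r + 2))"
proof -
  \<comment> \<open>Points of \<open>B\<close> near \<open>A\<close> have norm at most
    \<open>r + 1\<close>, and the stretched point \<open>u\<close> is at most 1 away from such a
    point. This accounts for both radii.\<close>
  let ?U = "cball 0 (r + 2)" and ?B = "B \<inter> cball 0 (r + 1)"
  obtain x0 where x0: "x0 \<in> A" using A(1) by (auto simp: bounded_sets_def)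
  with A(2) norm_ge_zero[of x0] have r: "0 \<le> r"
    by (metis mem_cball_0 order_trans subsetD)
  have approx: "\<exists>b\<in>?B. dist x b < e" if x: "x \<in> A" for x
  proof -
    have "B \<noteq> {}" using B by (simp add: bounded_sets_def)
    then obtain b where b: "b \<in> B" "dist x b < e"
      using near[OF x] by (auto simp: infdist_notempty cINF_less_iff)
    moreover have "norm b \<le> norm x + dist x b"
      by (metis dist_commute dist_norm norm_triangle_sub)
    moreover have "norm x \<le> r" using A(2) x by auto
    ultimately show ?thesis using e(2) by auto
  qed
  have U: "?U \<in> bounded_sets"
    using r by (intro bounded_sets_cball) simp
  have B': "?B \<in> bounded_sets"
    using approx[OF x0] B by (auto simp: bounded_sets_def)
  have "A \<subseteq> (*\<^sub>R) e ` ?U + (*\<^sub>R) (1 - e) ` ?B"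
  proof
    fix x assume "x \<in> A"
    then obtain b where b: "b \<in> ?B" "dist x b < e"
      using approx by blast
    define u where "u = b + (1 / e) *\<^sub>R (x - b)"
    have "norm u \<le> norm b + norm ((1 / e) *\<^sub>R (x - b))"
      unfolding u_def by (rule norm_triangle_ineq)
    also have "norm ((1 / e) *\<^sub>R (x - b)) \<le> 1"
      unfolding norm_scaleR using b(2) e by (simp add: dist_norm)
    finally have "u \<in> ?U" using b(1) by simp
    moreover have "x = e *\<^sub>R u + (1 - e) *\<^sub>R b"
      using e by (simp add: u_def algebra_simps)
    ultimately show "x \<in> (*\<^sub>R) e ` ?U + (*\<^sub>R) (1 - e) ` ?B"
      using b(1) by (auto intro!: set_plus_intro)
  qed
  then have "\<mu> A \<le> \<mu> ((*\<^sub>R) e ` ?U + (*\<^sub>R) (1 - e) ` ?B)"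
    by (intro convex_nonproperty_measureD(2)[OF \<mu>] bounded_sets_plus bounded_sets_scaleR U B' A)
  also have "\<dots> \<le> e * \<mu> ?U + (1 - e) * \<mu> ?B"
    using e by (intro convex_nonproperty_measureD(4)[OF \<mu> U B']) auto
  also have "(1 - e) * \<mu> ?B \<le> 1 * \<mu> B"
    using e convex_nonproperty_measureD(1)[OF \<mu> B'] convex_nonproperty_measureD(2)[OF \<mu> B B']
    by (intro mult_mono) auto
  finally show ?thesis by simp
qed

text \<open>Convexity is applied to one summand against the renormalized rest. The mass missing from
  1 is handed down to the empty sum \<open>{0}\<close>, where it costs nothing.\<close>

lemma convex_nonproperty_measure_subconvex_sum:
  assumes D: "fundamental_subsemigroup \<D>" and \<mu>: "convex_nonproperty_measure \<D> \<mu>"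
    and "finite W" and "\<And>w. w \<in> W \<Longrightarrow> B w \<in> bounded_sets"
    and "\<And>w. w \<in> W \<Longrightarrow> 0 \<le> m w" and "sum m W \<le> 1"
  shows "\<mu> (\<Sum>w\<in>W. (*\<^sub>R) (m w) ` B w) \<le> (\<Sum>w\<in>W. m w * \<mu> (B w))"
  using assms(3-)
proof (induction W arbitrary: m rule: finite_induct)
  case empty
  then show ?case
    using convex_nonproperty_measure_0[OF D \<mu>] by (simp add: set_zero)
next
  case (insert w W)
  \<comment> \<open>For \<open>m w = 1\<close> the division yields 0. The remaining weights then
    vanish too, so \<open>m v = (1 - m w) * n v\<close> holds in every case.\<close>
  define n where "n v = m v / (1 - m w)" for v
  have m: "0 \<le> m w" "\<And>v. v \<in> W \<Longrightarrow> 0 \<le> m v" "sum m W \<le> 1 - m w"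
    using insert by auto
  have mw: "m w \<le> 1"
    using m sum_nonneg[of W m] by auto
  have mv: "m v = (1 - m w) * n v" if "v \<in> W" for v
  proof (cases "m w = 1")
    case True
    with m have "sum m W = 0"
      using sum_nonneg[of W m] by auto
    then have "m v = 0"
      using sum_nonneg_eq_0_iff[of W m] m(2) insert.hyps(1) that by auto
    then show ?thesis using True by simp
  qed (simp add: n_def)
  have n: "\<And>v. v \<in> W \<Longrightarrow> 0 \<le> n v" "sum n W \<le> 1"
    using m mw by (auto simp: n_def divide_le_eq simp flip: sum_divide_distrib)
  let ?S = "\<Sum>v\<in>W. (*\<^sub>R) (n v) ` B v"
  have S: "?S \<in> bounded_sets"
    using insert by (intro bounded_sets_sum bounded_sets_scaleR) auto
  have "(\<Sum>v\<in>W. (*\<^sub>R) (m v) ` B v) = (*\<^sub>R) (1 - m w) ` ?S"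
    using insert.hyps(1) mv by (simp add: scaleR_image_sum image_image)
  then have "\<mu> (\<Sum>v\<in>insert w W. (*\<^sub>R) (m v) ` B v)
      = \<mu> ((*\<^sub>R) (m w) ` B w + (*\<^sub>R) (1 - m w) ` ?S)"
    using insert.hyps by simp
  also have "\<dots> \<le> m w * \<mu> (B w) + (1 - m w) * \<mu> ?S"
    using insert.prems mw by (intro convex_nonproperty_measureD(4)[OF \<mu> _ S]) auto
  also have "\<mu> ?S \<le> (\<Sum>v\<in>W. n v * \<mu> (B v))"
    using insert.prems n by (intro insert.IH) auto
  finally have "\<mu> (\<Sum>v\<in>insert w W. (*\<^sub>R) (m v) ` B v)
      \<le> m w * \<mu> (B w) + (1 - m w) * (\<Sum>v\<in>W. n v * \<mu> (B v))"
    using mw by (simp add: mult_left_mono)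
  also have "(1 - m w) * (\<Sum>v\<in>W. n v * \<mu> (B v)) = (\<Sum>v\<in>W. m v * \<mu> (B v))"
    using mv by (simp add: sum_distrib_left mult.assoc)
  finally show ?case
    using insert.hyps by simp
qed

lemma sublinear_nonproperty_measure_sum:
  assumes \<mu>: "sublinear_nonproperty_measure \<D> \<mu>" and zero: "\<mu> {0} = 0"
    and "finite W" and "\<And>w. w \<in> W \<Longrightarrow> B w \<in> bounded_sets"
    and "\<And>w. w \<in> W \<Longrightarrow> 0 \<le> m w"
  shows "\<mu> (\<Sum>w\<in>W. (*\<^sub>R) (m w) ` B w) \<le> (\<Sum>w\<in>W. m w * \<mu> (B w))"
  using assms(3-)
proof (induction W rule: finite_induct)
  case empty
  then show ?case by (simp add: set_zero zero)
next
  case (insert w W)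
  let ?S = "\<Sum>v\<in>W. (*\<^sub>R) (m v) ` B v"
  have "?S \<in> bounded_sets" "(*\<^sub>R) (m w) ` B w \<in> bounded_sets"
    using insert by (auto intro!: bounded_sets_sum bounded_sets_scaleR)
  then have "\<mu> ((*\<^sub>R) (m w) ` B w + ?S) \<le> \<mu> ((*\<^sub>R) (m w) ` B w) + \<mu> ?S"
    using \<mu> by (simp add: sublinear_nonproperty_measure_def)
  also have "\<mu> ((*\<^sub>R) (m w) ` B w) = m w * \<mu> (B w)"
    using \<mu> insert by (auto simp: sublinear_nonproperty_measure_def)
  also have "\<mu> ?S \<le> (\<Sum>v\<in>W. m v * \<mu> (B v))"
    using insert by auto
  finally show ?case using insert.hyps by simp
qed

section \<open>Support maps and distances between convex hulls\<close>

lemma blinfun_apply_le_SUP_support_map: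
  fixes G :: "('b \<Rightarrow> 'a::real_normed_vector) set"
  assumes bdd: "bounded (values_at G s)" "bounded (values_at G t)" and g: "g \<in> G"
    and \<phi>: "norm \<phi> \<le> 1"
  shows "blinfun_apply \<phi> (g s)
    \<le> (SUP h\<in>G. blinfun_apply \<phi> (h t)) + norm (support_map G s - support_map G t)"
proof -
  have ne: "G \<noteq> {}" using g by auto
  define u where "u = Abs_dual_ball \<phi>"
  have u: "functional_of u = \<phi>"
    unfolding u_def using \<phi> by (simp add: Abs_dual_ball_inverse)
  have "bdd_above ((\<lambda>g. blinfun_apply \<phi> (g s)) ` G)"
    using bounded_linear_image[OF bdd(1) blinfun.bounded_linear_right[of \<phi>]]
    by (simp add: values_at_def image_image bounded_imp_bdd_above)
  then have "blinfun_apply \<phi> (g s) \<le> apply_bcontfun (support_map G s) u"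
    unfolding apply_support_map[OF ne bdd(1)] u by (rule cSUP_upper[OF g])
  also have "\<dots> \<le> apply_bcontfun (support_map G t) u + norm (support_map G s - support_map G t)"
    using norm_bounded[of "support_map G s - support_map G t" u] by simp
  finally show ?thesis
    by (simp add: apply_support_map[OF ne bdd(2)] u)
qed

text \<open>The functional that separates \<open>g s\<close> from the hull at \<open>t\<close> by
  their distance is a point of the dual ball. At that point the two support maps differ by at most
  the sup-norm of their difference.\<close>

lemma infdist_convex_hull_values_at_le:
  fixes G :: "('b \<Rightarrow> 'a::real_normed_vector) set"
  assumes bdd: "bounded (values_at G s)" "bounded (values_at G t)" and g: "g \<in> G"
  shows "infdist (g s) (convex hull values_at G t) \<le> norm (support_map G s - support_map G t)"
proof -
  let ?C = "convex hull values_at G t"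
  have ne: "G \<noteq> {}" using g by auto
  obtain \<phi> :: "'a \<Rightarrow>\<^sub>L real" where \<phi>: "norm \<phi> \<le> 1"
    and sep: "\<And>c. c \<in> ?C \<Longrightarrow> blinfun_apply \<phi> c + infdist (g s) ?C \<le> blinfun_apply \<phi> (g s)"
    by (rule separating_functional_infdist[of ?C "g s"])
      (use ne in \<open>auto simp: convex_convex_hull values_at_def\<close>)
  have "(SUP h\<in>G. blinfun_apply \<phi> (h t)) \<le> blinfun_apply \<phi> (g s) - infdist (g s) ?C"
  proof (rule cSUP_least[OF ne])
    fix h assume "h \<in> G"
    then have "h t \<in> ?C" by (auto simp: values_at_def intro: hull_inc)
    then show "blinfun_apply \<phi> (h t) \<le> blinfun_apply \<phi> (g s) - infdist (g s) ?C"
      using sep by fastforce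
  qed
  then show ?thesis
    using blinfun_apply_le_SUP_support_map[OF bdd g \<phi>] by simp
qed

section \<open>Approximation outside sets with small integral of \<open>\<psi>\<close>\<close>

lemma integral_tail_less:
  fixes \<psi> :: "'a \<Rightarrow> real"
  assumes \<psi>: "integrable M \<psi>" and H: "\<And>n. H n \<in> sets M" "incseq H"
    and ae: "AE x in M. \<exists>n. x \<in> H n" and "0 < \<delta>"
  obtains n where "(\<integral>x. indicator (space M - H n) x * \<psi> x \<partial>M) < \<delta>"
proof -
  have [measurable]: "\<psi> \<in> borel_measurable M" using \<psi> by auto
  note [measurable] = H(1)
  have "(\<lambda>n. \<integral>x. indicator (space M - H n) x * \<psi> x \<partial>M) \<longlonglongrightarrow> (\<integral>x. 0 \<partial>M)"
  proof (rule integral_dominated_convergence)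
    show "integrable M (\<lambda>x. \<bar>\<psi> x\<bar>)" using \<psi> by simp
    show "AE x in M. (\<lambda>n. indicator (space M - H n) x * \<psi> x) \<longlonglongrightarrow> 0"
      using ae
    proof eventually_elim
      case (elim x)
      then obtain n where "x \<in> H n" ..
      then have "eventually (\<lambda>n. indicator (space M - H n) x * \<psi> x = 0) sequentially"
        unfolding eventually_sequentially
        by (intro exI[of _ n] allI impI) (use H(2) in \<open>auto simp: incseq_def indicator_def\<close>)
      then show ?case by (rule tendsto_eventually)
    qed
    show "AE x in M. norm (indicator (space M - H n) x * \<psi> x) \<le> \<bar>\<psi> x\<bar>" for n
      by (auto simp: indicator_def)
  qed auto
  then have "eventually (\<lambda>n. (\<integral>x. indicator (space M - H n) x * \<psi> x \<partial>M) < \<delta>) sequentially"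
    using \<open>0 < \<delta>\<close> by (intro order_tendstoD(2)) auto
  then show ?thesis
    using that by (auto simp: eventually_sequentially)
qed

text \<open>An argument in the style of Egorov: one simple function is uniformly close to
  \<open>F\<close> on a set that exhausts the space up to a small integral of \<open>\<psi>\<close>.
  The null set where \<open>P\<close> fails is discarded along the way.\<close>

lemma strongly_measurable_approx:
  fixes F :: "'a \<Rightarrow> 'b::real_normed_vector" and \<psi> :: "'a \<Rightarrow> real"
  assumes F: "strongly_measurable M F" and \<psi>: "integrable M \<psi>" and P: "AE x in M. P x"
    and "0 < \<eta>" "0 < \<delta>"
  obtains E f where "E \<in> sets M" and "simple_function M f" and "\<And>x. x \<in> E \<Longrightarrow> P x"
    and "\<And>x. x \<in> E \<Longrightarrow> norm (F x - f x) \<le> \<eta>"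
    and "(\<integral>x. indicator (space M - E) x * \<psi> x \<partial>M) < \<delta>"
proof -
  obtain f where f: "\<And>i. simple_function M (f i)" "AE x in M. (\<lambda>i. f i x) \<longlonglongrightarrow> F x"
    using F unfolding strongly_measurable_def by blast
  have "AE x in M. P x \<and> (\<lambda>i. f i x) \<longlonglongrightarrow> F x"
    using P f(2) by eventually_elim simp
  then obtain N where N: "{x \<in> space M. \<not> (P x \<and> (\<lambda>i. f i x) \<longlonglongrightarrow> F x)} \<subseteq> N" "emeasure M N = 0" "N \<in> sets M"
    by (rule AE_E)
  then have N0: "N \<in> null_sets M" by blast
  have [measurable]: "(\<lambda>x. norm (f i x - f j x)) \<in> borel_measurable M" for i j
    by (rule borel_measurable_simple_function[OF simple_function_compose2[OF f(1) f(1)]])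
  note [measurable] = N(3)
  \<comment> \<open>Closeness is tested between simple functions, which makes \<open>H k\<close>
    evidently measurable; letting \<open>i\<close> tend to infinity replaces \<open>f i\<close> by
    \<open>F\<close>.\<close>
  define H where "H k = {x \<in> space M. x \<notin> N \<and> (\<forall>i\<ge>k. \<forall>j\<ge>k. norm (f i x - f j x) \<le> \<eta>)}" for k
  have H: "H k \<in> sets M" for k
    unfolding H_def by measurable
  moreover have "incseq H"
    unfolding incseq_def H_def by (auto intro: order_trans)
  moreover have "AE x in M. \<exists>k. x \<in> H k"
    using AE_not_in[OF N0] AE_space
  proof eventually_elim
    case (elim x)
    then have "Cauchy (\<lambda>i. f i x)"
      using N(1) by (auto intro: LIMSEQ_imp_Cauchy)
    then obtain k where "\<And>i j. k \<le> i \<Longrightarrow> k \<le> j \<Longrightarrow> norm (f i x - f j x) < \<eta>"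
      using \<open>0 < \<eta>\<close> unfolding Cauchy_iff by blast
    then show ?case
      using elim by (auto simp: H_def intro: less_imp_le)
  qed
  ultimately obtain k where k: "(\<integral>x. indicator (space M - H k) x * \<psi> x \<partial>M) < \<delta>"
    using integral_tail_less[OF \<psi> _ _ _ \<open>0 < \<delta>\<close>] by blast
  show ?thesis
  proof (rule that[OF H f(1) _ _ k])
    fix x assume x: "x \<in> H k"
    show "P x"
      using x N(1) by (auto simp: H_def)
    have "(\<lambda>i. norm (f i x - f k x)) \<longlonglongrightarrow> norm (F x - f k x)"
      using x N(1) by (auto simp: H_def intro!: tendsto_intros)
    then show "norm (F x - f k x) \<le> \<eta>"
      by (rule LIMSEQ_le_const2) (use x in \<open>auto simp: H_def\<close>)
  qed
qed

section \<open>The integral inequality\<close>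

text \<open>The total mass takes the place of \<open>t\<close>. The error \<open>\<epsilon>\<close>
  is spent in two halves: one on the distance of the integrals from the finite sum \<open>K\<close>,
  one on the variation of \<open>\<mu>\<close> inside the cells.\<close>

lemma nonproperty_measure_strong_bochner_integral_le:
  fixes \<D> :: "'a::real_normed_vector set set" and G :: "('b \<Rightarrow> 'a) set" and \<psi> :: "'b \<Rightarrow> real"
  assumes "complete_measure M" and "finite_measure M"
    and D: "fundamental_subsemigroup \<D>" and \<mu>: "convex_nonproperty_measure \<D> \<mu>"
    and G: "G \<noteq> {}" "G \<subseteq> L1_space M"
    and \<psi>: "integrable M \<psi>" and dom: "AE s in M. \<forall>g\<in>G. norm (g s) \<le> \<psi> s"
    and J: "strongly_measurable M (support_map G)"
    and size: "measure M (space M) \<le> 1 \<or> sublinear_nonproperty_measure \<D> \<mu>"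
  shows "ennreal (\<mu> (strong_bochner_integral M ` G)) \<le> (\<integral>\<^sup>+s. ennreal (\<mu> (values_at G s)) \<partial>M)"
proof (rule ennreal_le_epsilon)
  fix \<epsilon> :: real assume "0 < \<epsilon>"
  interpret complete_measure M by fact
  interpret finite_measure M by fact
  let ?Y = "strong_bochner_integral M ` G"

  \<comment> \<open>Constants of the error budget\<close>
  define m where "m = measure M (space M)"
  have m: "0 \<le> m" by (simp add: m_def)
  obtain g0 where g0: "g0 \<in> G" using G(1) by blast
  have \<psi>_nonneg: "AE s in M. 0 \<le> \<psi> s"
    using dom by eventually_elim (use g0 norm_ge_zero order_trans in blast)
  define V where "V = (\<integral>s. \<psi> s \<partial>M)"
  have V: "0 \<le> V"
    unfolding V_def by (rule integral_nonneg_AE[OF \<psi>_nonneg])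
  \<comment> \<open>The perturbation constant for the set of integrals, which lies in the ball of
    radius \<open>V\<close>.\<close>
  define T where "T = \<mu> (cball 0 (V + 2))"
  have T: "0 \<le> T"
    unfolding T_def using V by (intro convex_nonproperty_measureD(1)[OF \<mu>] bounded_sets_cball) simp
  \<comment> \<open>The integrals will lie within \<open>3 * \<delta>\<close> of \<open>K\<close>.
    The first bound makes this an admissible perturbation, the second keeps its cost below
    \<open>\<epsilon> / 2\<close>; \<open>T + 1\<close> avoids division by zero.\<close>
  define \<delta> where "\<delta> = min (1 / 3) (\<epsilon> / (6 * (T + 1)))"
  have \<delta>: "0 < \<delta>" "3 * \<delta> \<le> 1" "3 * \<delta> * T \<le> \<epsilon> / 2"
  proof -
    show "0 < \<delta>" "3 * \<delta> \<le> 1"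
      using T \<open>0 < \<epsilon>\<close> by (auto simp: \<delta>_def)
    have "\<delta> * T \<le> \<epsilon> / (6 * (T + 1)) * (T + 1)"
      using T \<open>0 < \<epsilon>\<close> by (intro mult_mono) (auto simp: \<delta>_def)
    also have "\<dots> = \<epsilon> / 6" using T by (simp add: field_simps)
    finally show "3 * \<delta> * T \<le> \<epsilon> / 2" by simp
  qed
  have [measurable]: "\<psi> \<in> borel_measurable M" using \<psi> by auto
  \<comment> \<open>Truncating \<open>\<psi>\<close> confines the remaining sets
    \<open>values_at G s\<close> to a single ball, so one perturbation constant \<open>L\<close>
    serves all cells.\<close>
  obtain N :: nat where N: "(\<integral>s. indicator (space M - {s \<in> space M. \<psi> s \<le> real N}) s * \<psi> s \<partial>M) < \<delta> / 2"
  proof (rule integral_tail_less[OF \<psi>, where H = "\<lambda>n. {s \<in> space M. \<psi> s \<le> real n}" and \<delta> = "\<delta> / 2"])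
    show "incseq (\<lambda>n. {s \<in> space M. \<psi> s \<le> real n})"
      unfolding incseq_def by (auto intro: order_trans)
    show "AE s in M. \<exists>n. s \<in> {s \<in> space M. \<psi> s \<le> real n}"
      using AE_space by eventually_elim (auto intro: real_arch_simple)
  qed (use \<delta> in auto)
  define L where "L = \<mu> (cball 0 (real N + 2))"
  have L: "0 \<le> L"
    unfolding L_def by (intro convex_nonproperty_measureD(1)[OF \<mu>] bounded_sets_cball) simp
  \<comment> \<open>\<open>\<eta>\<close> bounds the oscillation inside a cell. Its three bounds
    serve, in turn, the admissibility of \<open>2 * \<eta>\<close> as a perturbation, the distance
    to \<open>K\<close>, and the total change of \<open>\<mu>\<close> over the cells.\<close>
  define \<eta> where "\<eta> = min (1 / 2) (min (\<delta> / (2 * (m + 1))) (\<epsilon> / (4 * (L * m + 1))))"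
  have Lm: "0 \<le> L * m" using L m by simp
  have \<eta>: "0 < \<eta>" "2 * \<eta> \<le> 1" "2 * \<eta> * m \<le> \<delta>" "2 * \<eta> * (L * m) \<le> \<epsilon> / 2"
  proof -
    show "0 < \<eta>"
      using m Lm \<delta>(1) \<open>0 < \<epsilon>\<close> by (simp add: \<eta>_def add_nonneg_pos)
    show "2 * \<eta> \<le> 1" by (simp add: \<eta>_def)
    have "\<eta> * m \<le> \<delta> / (2 * (m + 1)) * (m + 1)"
      using m \<delta>(1) by (intro mult_mono) (auto simp: \<eta>_def)
    also have "\<dots> = \<delta> / 2" using m by (simp add: field_simps)
    finally show "2 * \<eta> * m \<le> \<delta>" by simp
    have "\<eta> * (L * m) \<le> \<epsilon> / (4 * (L * m + 1)) * (L * m + 1)"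
      using Lm \<open>0 < \<epsilon>\<close> by (intro mult_mono) (auto simp: \<eta>_def)
    also have "\<dots> = \<epsilon> / 4" using Lm by (simp add: field_simps)
    finally show "2 * \<eta> * (L * m) \<le> \<epsilon> / 2" by simp
  qed

  \<comment> \<open>Partition into cells of small oscillation\<close>
  obtain E' f where E'[measurable]: "E' \<in> sets M" and f: "simple_function M f"
    and dom_E': "\<And>s. s \<in> E' \<Longrightarrow> \<forall>g\<in>G. norm (g s) \<le> \<psi> s"
    and close: "\<And>s. s \<in> E' \<Longrightarrow> norm (support_map G s - f s) \<le> \<eta> / 2"
    and tail: "(\<integral>s. indicator (space M - E') s * \<psi> s \<partial>M) < \<delta> / 2"
    by (rule strongly_measurable_approx[OF J \<psi> dom, of "\<eta> / 2" "\<delta> / 2"]) (use \<eta> \<delta> in auto)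
  define E where "E = {s \<in> E'. \<psi> s \<le> real N}"
  have E_space: "E \<subseteq> space M"
    using sets.sets_into_space[OF E'] by (auto simp: E_def)
  have E_eq: "E = {s \<in> space M. s \<in> E' \<and> \<psi> s \<le> real N}"
    using sets.sets_into_space[OF E'] by (auto simp: E_def)
  have E[measurable]: "E \<in> sets M"
    unfolding E_eq by measurable
  have norm_E: "norm (g s) \<le> real N" if "s \<in> E" "g \<in> G" for s g
    using that dom_E' by (force simp: E_def)
  have tail_E: "(\<integral>s. indicator (space M - E) s * \<psi> s \<partial>M) \<le> \<delta>"
  proof -
    let ?A = "space M - {s \<in> space M. \<psi> s \<le> real N}" and ?B = "space M - E'"
    have int: "integrable M (\<lambda>s. indicator A s * \<psi> s)" if "A \<in> sets M" for A
      using integrable_mult_indicator[OF that \<psi>] by simp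
    have "(\<integral>s. indicator (space M - E) s * \<psi> s \<partial>M)
        \<le> (\<integral>s. indicator ?A s * \<psi> s + indicator ?B s * \<psi> s \<partial>M)"
    proof (rule integral_mono_AE)
      show "AE s in M. indicator (space M - E) s * \<psi> s
          \<le> indicator ?A s * \<psi> s + indicator ?B s * \<psi> s"
        using \<psi>_nonneg by eventually_elim (auto simp: indicator_def E_def)
    qed (intro Bochner_Integration.integrable_add int; measurable)+
    also have "\<dots> = (\<integral>s. indicator ?A s * \<psi> s \<partial>M) + (\<integral>s. indicator ?B s * \<psi> s \<partial>M)"
      by (intro Bochner_Integration.integral_add int) measurable
    finally show ?thesis using N tail by simp
  qed
  define W where "W = f ` E"
  define cell where "cell w = E \<inter> f -` {w}" for w
  define c where "c w = (SOME s. s \<in> cell w)" for w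
  have W: "finite W"
    unfolding W_def using simple_functionD(1)[OF f] E_space by (meson finite_subset image_mono)
  have cell[measurable]: "cell w \<in> sets M" for w
  proof -
    have "cell w = E \<inter> (f -` {w} \<inter> space M)"
      using E_space by (auto simp: cell_def)
    then show ?thesis using simple_functionD(2)[OF f] by auto
  qed
  have c: "c w \<in> E" "f (c w) = w" if "w \<in> W" for w
  proof -
    have "\<exists>s. s \<in> cell w" using that by (auto simp: W_def cell_def)
    then have "c w \<in> cell w" unfolding c_def by (rule someI_ex)
    then show "c w \<in> E" "f (c w) = w" by (auto simp: cell_def)
  qed
  \<comment> \<open>Polymorphic in the values, as it is applied both to real cell constants and to
    extended nonnegative ones.\<close>
  have sum_cell: "(\<Sum>w\<in>W. indicator (cell w) s * a w) = (if s \<in> E then a (f s) else 0)"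
    for s and a :: "_ \<Rightarrow> 'c::comm_semiring_1"
  proof (cases "s \<in> E")
    case True
    then have "f s \<in> W" by (simp add: W_def)
    have "(\<Sum>w\<in>W. indicator (cell w) s * a w) = (\<Sum>w\<in>W. if w = f s then a w else 0)"
      by (rule sum.cong) (use True in \<open>auto simp: cell_def\<close>)
    with \<open>f s \<in> W\<close> W True show ?thesis by simp
  qed (simp add: cell_def)
  define p where "p w = measure M (cell w)" for w
  have p: "0 \<le> p w" for w by (simp add: p_def)
  have sum_p: "sum p W \<le> m"
  proof -
    have "sum p W = measure M (\<Union>w\<in>W. cell w)"
      unfolding p_def using W
      by (intro finite_measure_finite_Union[symmetric])
        (use cell in \<open>auto simp: disjoint_family_on_def cell_def[abs_def]\<close>)
    also have "\<dots> \<le> m"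
      unfolding m_def by (rule bounded_measure)
    finally show ?thesis .
  qed
  have bdd: "bounded (values_at G s)" if "s \<in> E" for s
    using norm_E[OF that] by (auto simp: values_at_def bounded_iff)
  have bs: "values_at G s \<in> bounded_sets" if "s \<in> E" for s
    using bdd[OF that] G(1) by (auto simp: bounded_sets_def values_at_def)
  have osc: "norm (support_map G s - support_map G s') \<le> \<eta>"
    if "s \<in> E" "s' \<in> E" "f s = f s'" for s s'
    using norm_triangle_ineq4[of "support_map G s - f s" "support_map G s' - f s'"]
      close[of s] close[of s'] that by (simp add: E_def)
  \<comment> \<open>Passing to hulls makes \<open>K\<close> convex, so that it can be separated from
    a point, and leaves \<open>\<mu>\<close> unchanged.\<close>
  define B where "B w = convex hull (values_at G (c w))" for w
  have B: "B w \<in> bounded_sets" if "w \<in> W" for w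
    unfolding B_def by (intro bounded_sets_convex_hull bs c that)
  have \<mu>_B: "\<mu> (B w) = \<mu> (values_at G (c w))" if "w \<in> W" for w
    unfolding B_def by (intro convex_nonproperty_measureD(3)[OF \<mu>] bs c that)
  define K where "K = (\<Sum>w\<in>W. (*\<^sub>R) (p w) ` B w)"
  have K: "K \<in> bounded_sets"
    unfolding K_def by (intro bounded_sets_sum bounded_sets_scaleR W B)
  have K_convex: "convex K"
    unfolding K_def B_def by (intro convex_set_sum convex_scaling convex_convex_hull)
  have \<mu>_K: "\<mu> K \<le> (\<Sum>w\<in>W. p w * \<mu> (B w))"
    using size
  proof
    assume "measure M (space M) \<le> 1"
    with sum_p show ?thesis
      unfolding K_def by (intro convex_nonproperty_measure_subconvex_sum[OF D \<mu> W] B p) (auto simp: m_def)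
  next
    assume "sublinear_nonproperty_measure \<D> \<mu>"
    then show ?thesis
      unfolding K_def
      by (intro sublinear_nonproperty_measure_sum convex_nonproperty_measure_0[OF D \<mu>] W B p)
  qed
  \<comment> \<open>The perturbation size is \<open>2 * \<eta>\<close> because a strict bound is
    required while the oscillation is only known to be at most \<open>\<eta>\<close>.\<close>
  have cell_le: "\<mu> (B w) \<le> \<mu> (values_at G s) + 2 * \<eta> * L" if s: "s \<in> E" and w: "w = f s" for s w
  proof -
    have wW: "w \<in> W" using s w by (simp add: W_def)
    note cw = c[OF wW]
    have "\<mu> (values_at G (c w)) \<le> \<mu> (convex hull (values_at G s)) + 2 * \<eta> * L"
      unfolding L_def
    proof (rule convex_nonproperty_measure_perturb[OF \<mu> bs[OF cw(1)]])
      show "values_at G (c w) \<subseteq> cball 0 (real N)"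
        using norm_E[OF cw(1)] by (auto simp: values_at_def)
      show "convex hull (values_at G s) \<in> bounded_sets"
        by (intro bounded_sets_convex_hull bs s)
      fix x assume "x \<in> values_at G (c w)"
      then obtain g where g: "g \<in> G" "x = g (c w)" by (auto simp: values_at_def)
      have "infdist x (convex hull (values_at G s)) \<le> norm (support_map G (c w) - support_map G s)"
        unfolding g(2) by (intro infdist_convex_hull_values_at_le bdd cw s g)
      also have "\<dots> \<le> \<eta>"
        using cw s w by (intro osc) auto
      finally show "infdist x (convex hull (values_at G s)) < 2 * \<eta>"
        using \<eta>(1) by simp
    qed (use \<eta> in auto)
    then show ?thesis
      by (simp add: \<mu>_B[OF wW] convex_nonproperty_measureD(3)[OF \<mu> bs[OF s]])
  qed

  \<comment> \<open>Distance of the integrals from \<open>K\<close>\<close>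
  have int_G: "has_bochner_integral M (\<lambda>s. blinfun_apply \<phi> (g s)) (blinfun_apply \<phi> (strong_bochner_integral M g))"
    if "g \<in> G" for g and \<phi> :: "'a \<Rightarrow>\<^sub>L real"
  proof -
    obtain x where x: "has_strong_bochner_integral M g x"
      using G(2) \<open>g \<in> G\<close> by (auto simp: L1_space_def)
    show ?thesis
      unfolding strong_bochner_integral_eq[OF x] by (rule has_bochner_integral_blinfun_apply[OF x])
  qed
  have \<phi>_le: "blinfun_apply \<phi> y \<le> norm y" if "norm \<phi> \<le> 1" for \<phi> :: "'a \<Rightarrow>\<^sub>L real" and y
    using norm_blinfun[of \<phi> y] mult_right_mono[OF that norm_ge_zero[of y]] by simp
  have Y_norm: "norm (strong_bochner_integral M g) \<le> V" if "g \<in> G" for g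
  proof -
    obtain \<phi> :: "'a \<Rightarrow>\<^sub>L real" where \<phi>: "norm \<phi> \<le> 1"
      "\<And>c. c \<in> {0} \<Longrightarrow> blinfun_apply \<phi> c + infdist (strong_bochner_integral M g) {0}
        \<le> blinfun_apply \<phi> (strong_bochner_integral M g)"
      by (rule separating_functional_infdist[of "{0}" "strong_bochner_integral M g"]) auto
    have "norm (strong_bochner_integral M g) \<le> blinfun_apply \<phi> (strong_bochner_integral M g)"
      using \<phi>(2)[of 0] by (simp add: blinfun.zero_right)
    also have "\<dots> = (\<integral>s. blinfun_apply \<phi> (g s) \<partial>M)"
      using has_bochner_integral_integral_eq[OF int_G[OF that]] by simp
    also have "\<dots> \<le> V"
      unfolding V_def
    proof (rule integral_mono_AE)
      show "integrable M (\<lambda>s. blinfun_apply \<phi> (g s))"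
        using int_G[OF that] by (rule integrable.intros)
      show "AE s in M. blinfun_apply \<phi> (g s) \<le> \<psi> s"
        using dom by eventually_elim (use \<phi>_le[OF \<phi>(1)] that order_trans in blast)
    qed (rule \<psi>)
    finally show ?thesis .
  qed
  have Y: "?Y \<in> bounded_sets" "?Y \<subseteq> cball 0 V"
    using G(1) Y_norm by (auto simp: bounded_sets_def bounded_iff)
  \<comment> \<open>After separating \<open>y\<close> from \<open>K\<close> by
    \<open>\<phi>\<close>, it suffices to find one \<open>x\<close> in \<open>K\<close> with
    \<open>blinfun_apply \<phi> y\<close> at most \<open>2 * \<delta>\<close> above
    \<open>blinfun_apply \<phi> x\<close>.\<close>
  have near: "infdist y K < 3 * \<delta>" if y: "y \<in> ?Y" for y
  proof -
    obtain g where g: "g \<in> G" "y = strong_bochner_integral M g"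
      using y by blast
    obtain \<phi> :: "'a \<Rightarrow>\<^sub>L real" where \<phi>: "norm \<phi> \<le> 1"
      and sep: "\<And>x. x \<in> K \<Longrightarrow> blinfun_apply \<phi> x + infdist y K \<le> blinfun_apply \<phi> y"
      by (rule separating_functional_infdist[OF K_convex, of y]) (use K in \<open>auto simp: bounded_sets_def\<close>)
    \<comment> \<open>One \<open>h\<close> serves the whole cell: it nearly attains the supremum of
      \<open>\<phi>\<close> at the sample point. One \<open>\<eta>\<close> pays for this choice, the
      other for the oscillation.\<close>
    have "\<exists>h\<in>G. \<forall>s\<in>cell w. blinfun_apply \<phi> (g s) \<le> blinfun_apply \<phi> (h (c w)) + 2 * \<eta>" if "w \<in> W" for w
    proof -
      note cw = c[OF that]
      let ?S = "SUP h\<in>G. blinfun_apply \<phi> (h (c w))"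
      have "bdd_above ((\<lambda>h. blinfun_apply \<phi> (h (c w))) ` G)"
        using \<phi>_le[OF \<phi>] norm_E[OF cw(1)] by (auto intro!: bdd_aboveI2 intro: order_trans)
      then obtain h where h: "h \<in> G" "?S - \<eta> < blinfun_apply \<phi> (h (c w))"
        using less_cSUP_iff[OF G(1), of "\<lambda>h. blinfun_apply \<phi> (h (c w))" "?S - \<eta>"] \<eta>(1) by auto
      have "blinfun_apply \<phi> (g s) \<le> blinfun_apply \<phi> (h (c w)) + 2 * \<eta>" if "s \<in> cell w" for s
      proof -
        have s: "s \<in> E" "f s = f (c w)" using that cw by (auto simp: cell_def)
        have "blinfun_apply \<phi> (g s) \<le> ?S + norm (support_map G s - support_map G (c w))"
          by (intro blinfun_apply_le_SUP_support_map bdd s cw g \<phi>)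
        then show ?thesis
          using osc[OF s(1) cw(1) s(2)] h(2) by simp
      qed
      with h(1) show ?thesis by blast
    qed
    then obtain h where h: "\<And>w. w \<in> W \<Longrightarrow> h w \<in> G"
      and h_le: "\<And>w s. w \<in> W \<Longrightarrow> s \<in> cell w \<Longrightarrow>
        blinfun_apply \<phi> (g s) \<le> blinfun_apply \<phi> (h w (c w)) + 2 * \<eta>"
      by metis
    define x where "x = (\<Sum>w\<in>W. p w *\<^sub>R h w (c w))"
    have "x \<in> K"
      unfolding x_def K_def set_sum_alt[OF W]
      using h by (auto simp: B_def values_at_def intro!: exI[of _ "\<lambda>w. p w *\<^sub>R h w (c w)"] imageI hull_inc)
    define b where "b w = blinfun_apply \<phi> (h w (c w)) + 2 * \<eta>" for w
    \<comment> \<open>An integrable majorant of \<open>\<phi>\<close> along \<open>g\<close>: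
      constant on each cell, and \<open>\<psi>\<close> outside \<open>E\<close>.\<close>
    let ?v = "\<lambda>s. (\<Sum>w\<in>W. indicator (cell w) s * b w) + indicator (space M - E) s * \<psi> s"
    have int_cell: "integrable M (\<lambda>s. indicator (cell w) s * b w)" for w
      by (intro integrable_mult_left integrable_real_indicator cell) (simp add: less_top[symmetric])
    have int_sum: "integrable M (\<lambda>s. \<Sum>w\<in>W. indicator (cell w) s * b w)"
      by (rule Bochner_Integration.integrable_sum[OF int_cell])
    have int_tail: "integrable M (\<lambda>s. indicator (space M - E) s * \<psi> s)"
      using integrable_mult_indicator[OF _ \<psi>, of "space M - E"] by simp
    have "blinfun_apply \<phi> y = (\<integral>s. blinfun_apply \<phi> (g s) \<partial>M)"
      using has_bochner_integral_integral_eq[OF int_G[OF g(1)]] by (simp add: g(2))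
    also have "\<dots> \<le> (\<integral>s. ?v s \<partial>M)"
    proof (rule integral_mono_AE)
      show "integrable M (\<lambda>s. blinfun_apply \<phi> (g s))"
        using int_G[OF g(1)] by (rule integrable.intros)
      show "integrable M ?v"
        by (intro Bochner_Integration.integrable_add int_sum int_tail)
      show "AE s in M. blinfun_apply \<phi> (g s) \<le> ?v s"
        using dom AE_space
      proof eventually_elim
        case (elim s)
        show ?case
        proof (cases "s \<in> E")
          case True
          then have "f s \<in> W" "s \<in> cell (f s)"
            by (auto simp: W_def cell_def)
          with h_le True show ?thesis
            by (simp add: sum_cell b_def)
        next
          case False
          then show ?thesis
            using elim g(1) order_trans[OF \<phi>_le[OF \<phi>]] by (simp add: sum_cell)
        qed
      qed
    qed
    also have "\<dots> = (\<Sum>w\<in>W. p w * b w) + (\<integral>s. indicator (space M - E) s * \<psi> s \<partial>M)"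
      by (simp add: Bochner_Integration.integral_add[OF int_sum int_tail]
          Bochner_Integration.integral_sum[OF int_cell] p_def)
    also have "(\<Sum>w\<in>W. p w * b w) = blinfun_apply \<phi> x + 2 * \<eta> * sum p W"
      by (simp add: x_def b_def blinfun.sum_right blinfun.scaleR_right sum.distrib distrib_left
          sum_distrib_left sum_distrib_right mult.commute)
    finally have "blinfun_apply \<phi> y \<le> blinfun_apply \<phi> x + 2 * \<eta> * sum p W + \<delta>"
      using tail_E by simp
    moreover have "2 * \<eta> * sum p W \<le> \<delta>"
      using order_trans[OF mult_left_mono[OF sum_p, of "2 * \<eta>"] \<eta>(3)] \<eta>(1) by simp
    ultimately show ?thesis
      using sep[OF \<open>x \<in> K\<close>] \<delta>(1) by simp
  qed
  \<comment> \<open>A nonnegative cell constant lying below \<open>\<mu> (values_at G s)\<close>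
    throughout the cell. The cut at 0 allows the weighted sum to be rewritten as a nonnegative
    integral of a step function.\<close>
  define q where "q w = max 0 (\<mu> (B w) - 2 * \<eta> * L)" for w
  have "\<mu> ?Y \<le> \<mu> K + 3 * \<delta> * T"
    unfolding T_def using \<delta> near by (intro convex_nonproperty_measure_perturb[OF \<mu> Y K]) auto
  also have "\<dots> \<le> (\<Sum>w\<in>W. p w * \<mu> (B w)) + \<epsilon> / 2"
    using \<mu>_K \<delta>(3) by simp
  also have "(\<Sum>w\<in>W. p w * \<mu> (B w)) \<le> (\<Sum>w\<in>W. p w * (q w + 2 * \<eta> * L))"
    by (intro sum_mono mult_left_mono p) (auto simp: q_def)
  also have "\<dots> = (\<Sum>w\<in>W. p w * q w) + 2 * \<eta> * (L * sum p W)"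
    by (simp add: distrib_left sum.distrib sum_distrib_left mult_ac)
  also have "2 * \<eta> * (L * sum p W) \<le> 2 * \<eta> * (L * m)"
    using \<eta>(1) L sum_p by (intro mult_left_mono) auto
  finally have "\<mu> ?Y \<le> (\<Sum>w\<in>W. p w * q w) + \<epsilon>"
    using \<eta>(4) by simp
  then have "ennreal (\<mu> ?Y) \<le> ennreal (\<Sum>w\<in>W. p w * q w) + ennreal \<epsilon>"
    using \<open>0 < \<epsilon>\<close> p by (subst ennreal_plus[symmetric]) (auto intro!: ennreal_leI sum_nonneg simp: q_def)
  also have "ennreal (\<Sum>w\<in>W. p w * q w) = (\<Sum>w\<in>W. ennreal (q w) * emeasure M (cell w))"
    using p by (subst sum_ennreal[symmetric])
      (auto simp: q_def ennreal_mult emeasure_eq_measure p_def mult.commute intro!: sum.cong)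
  also have "\<dots> = (\<integral>\<^sup>+s. (\<Sum>w\<in>W. indicator (cell w) s * ennreal (q w)) \<partial>M)"
    by (subst nn_integral_sum) (auto simp: nn_integral_cmult_indicator cell mult.commute)
  also have "\<dots> \<le> (\<integral>\<^sup>+s. ennreal (\<mu> (values_at G s)) \<partial>M)"
  proof (rule nn_integral_mono)
    fix s
    have "q (f s) \<le> \<mu> (values_at G s)" if "s \<in> E"
      using cell_le[OF that refl] convex_nonproperty_measureD(1)[OF \<mu> bs[OF that]]
      by (simp add: q_def)
    then show "(\<Sum>w\<in>W. indicator (cell w) s * ennreal (q w)) \<le> ennreal (\<mu> (values_at G s))"
      by (auto simp: sum_cell intro: ennreal_leI)
  qed
  finally show "ennreal (\<mu> ?Y) \<le> (\<integral>\<^sup>+s. ennreal (\<mu> (values_at G s)) \<partial>M) + ennreal \<epsilon>"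
    by (simp add: add_right_mono)
qed

theorem corollary6p7:
  fixes \<D> :: "'a::banach set set"
    and \<mu> :: "'a set \<Rightarrow> real"
    and a t :: real
    and G :: "(real \<Rightarrow> 'a) set"
    and \<psi> :: "real \<Rightarrow> real"
  assumes infinite_dim: "\<nexists>S :: 'a set. finite S \<and> span S = UNIV"
    and "fundamental_subsemigroup \<D>"
    and "convex_nonproperty_measure \<D> \<mu>"
    and "0 < a"
    and "G \<noteq> {}" and "G \<subseteq> L1_space (lebesgue_on {0..a})"
    and "L1_bounded (lebesgue_on {0..a}) G"
    and "integrable (lebesgue_on {0..a}) \<psi>" and "\<forall>s\<in>{0..a}. 0 \<le> \<psi> s"
    and "AE s in lebesgue_on {0..a}. \<forall>g\<in>G. norm (g s) \<le> \<psi> s"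
    and "strongly_measurable (lebesgue_on {0..a}) (support_map G)"
    and "0 < t" and "t \<le> a"
    and "t \<le> min 1 a \<or> sublinear_nonproperty_measure \<D> \<mu>"
  shows "ennreal (\<mu> (strong_bochner_integral (lebesgue_on {0..t}) ` G))
    \<le> (\<integral>\<^sup>+s\<in>{0..t}. ennreal (\<mu> (values_at G s)) \<partial>lebesgue)"
proof -
  \<comment> \<open>All data are restricted from \<open>{0..a}\<close> to \<open>{0..t}\<close>, a
    space of total mass \<open>t\<close>, so that the first alternative becomes total mass at most
    1.\<close>
  let ?A = "lebesgue_on {0..a}" and ?T = "lebesgue_on {0..t}"
  have sets_T: "{0..t} \<in> sets ?A"
    using \<open>t \<le> a\<close> by (simp add: sets_restrict_space_iff)
  have T_eq: "restrict_space ?A {0..t} = ?T"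
    using \<open>t \<le> a\<close> by (subst restrict_restrict_space) (auto simp: Int_absorb1)
  interpret A: complete_measure ?A
    by (rule completion.complete_measure_restrict_space) simp
  have complete: "complete_measure ?T"
    by (rule completion.complete_measure_restrict_space) simp
  have finite: "finite_measure ?T"
    by (rule finite_measureI) (use \<open>0 < t\<close> in \<open>simp add: space_restrict_space emeasure_restrict_space\<close>)
  have "G \<subseteq> L1_space ?T"
  proof
    fix g assume "g \<in> G"
    then obtain x where "has_strong_bochner_integral ?A g x"
      using \<open>G \<subseteq> L1_space ?A\<close> by (auto simp: L1_space_def)
    from A.has_strong_bochner_integral_restrict_space[OF this sets_T]
    show "g \<in> L1_space ?T" by (simp add: T_eq L1_space_def)
  qed
  moreover have "integrable (restrict_space ?A {0..t}) \<psi>"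
  proof (subst integrable_restrict_space)
    show "{0..t} \<inter> space ?A \<in> sets ?A"
      using sets_T by (simp only: sets.Int_space_eq2)
  qed (rule integrable_mult_indicator[OF sets_T assms(8)])
  then have "integrable ?T \<psi>" by (simp add: T_eq)
  moreover have "AE s in ?T. \<forall>g\<in>G. norm (g s) \<le> \<psi> s"
    using AE_restrict_spaceI[OF assms(10) sets_T] by (simp only: T_eq)
  moreover have "strongly_measurable ?T (support_map G)"
    using strongly_measurable_restrict_space[OF assms(11) sets_T] by (simp add: T_eq)
  moreover have "measure ?T (space ?T) \<le> 1 \<or> sublinear_nonproperty_measure \<D> \<mu>"
    using assms(14) \<open>0 < t\<close> by (auto simp: measure_restrict_space)
  ultimately have "ennreal (\<mu> (strong_bochner_integral ?T ` G))
      \<le> (\<integral>\<^sup>+s. ennreal (\<mu> (values_at G s)) \<partial>?T)"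
    using assms(2,3,5) by (intro nonproperty_measure_strong_bochner_integral_le[OF complete finite])
  also have "\<dots> = (\<integral>\<^sup>+s\<in>{0..t}. ennreal (\<mu> (values_at G s)) \<partial>lebesgue)"
    by (subst nn_integral_restrict_space) auto
  finally show ?thesis .
qed

end
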